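(* Let $N\ge 1$ and consider an $N$-person non-cooperative game with mixed strategy spaces $\mathbb{A}_1,\dots,\mathbb{A}_N$ (finite-dimensional simplices) and cost functions $r_i:\mathbb{A}_i\times\mathbb{A}_{-i}\to\mathbb{R}$, $i=1,\dots,N$. Suppose that for each $i$ the best-response set $R_i(a_{-i})$ is a non-empty compact subset of $\mathbb{A}_i$ for every $a_{-i}\in\mathbb{A}_{-i}$, that the best-response map $R_i:\mathbb{A}_{-i}\to\mathcal{H}_c(\mathbb{A}_i)$ is continuous, and that $r_i$ is weakly configurable. Then $$\bigcap_{i=1}^N \mathrm{gr}(R_i)\neq\emptyset .$$ Equivalently, the game has at least one Nash equilibrium.
   Context: Game: for each player $i$, $\mathbb{A}_i$ is the space of probability measures on a finite set of cardinality $n_i+1$, i.e. an $n_i$-dimensional simplex (with the Euclidean metric). Put $\mathbb{A}=\mathbb{A}_1\times\cdots\times\mathbb{A}_N$ and $\mathbb{A}_{-i}=\prod_{j\ne i}\mathbb{A}_j$; for $a\in\mathbb{A}$, $a_{-i}\in\mathbb{A}_{-i}$ is $a$ with its $i$-th entry deleted. Reordering variables, $\mathbb{A}$ is identified with $\mathbb{A}_i\times\mathbb{A}_{-i}$ and with $\mathbb{A}_{-i}\times\mathbb{A}_i$, so that $r_i(a)=r_i(a_i,a_{-i})$. Each player wants to minimize his cost. A Nash equilibrium is a point $a^*\in\mathbb{A}$ with $r_i(a^* )\le r_i(a_i,a^*_{-i})$ for all $a_i\in\mathbb{A}_i$ and all $i$. For a metric space $X$, $\mathcal{H}_c(X)$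 is the space of non-empty compact subsets of $X$ with the Hausdorff metric $d_H$. Best response: $R_i(a_{-i})=\{x\in\mathbb{A}_i : r_i(x,a_{-i})=\min_{y\in\mathbb{A}_i} r_i(y,a_{-i})\}$. Graph: $\mathrm{gr}(R_i)=\{(a_{-i},a_i): a_{-i}\in\mathbb{A}_{-i},\ a_i\in R_i(a_{-i})\}$, regarded as a subset of $\mathbb{A}$. Configuration space: $C_M(X)=X^M/\Sigma_M$ (quotient by the symmetric group permuting coordinates), with metric $d_M([x_1,\dots,x_M],[y_1,\dots,y_M])=\min_{\sigma\in\Sigma_M}\sup_j d(x_{\sigma(j)},y_j)$; $q_M$ sends $[x_1,\dots,x_M]$ to the set $\{x_1,\dots,x_M\}$. A function $f:\mathbb{A}_{-i}\to\mathcal{H}_c(\mathbb{A}_i)$ (not assumed continuous) can be subset-lifted to $C_M(\mathbb{A}_i)$ if there is a continuous map $f^M:\mathbb{A}_{-i}\to C_M(\mathbb{A}_i)$ with $q_M(f^M(a))\subset f(a)$ for every $a\in\mathbb{A}_{-i}$. The cost function $r_i$ is weakly configurable if for every $\epsilon>0$ there is a function $R_{i,\epsilon}:\mathbb{A}_{-i}\to\mathcal{H}_c(\mathbb{A}_i)$ such that (1) $R_{i,\epsilon}$ can be subset-lifted to $C_M(\mathbb{A}_i)$ for some positive integer $M$ (which may depend on $\epsilon$), and (2) $d_H(R_i(a_{-i}),R_{i,\epsilon}(a_{-i}))<\epsilon$ for all $a_{-i}\in\mathbb{A}_{-i}$. *)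

theory Defs
  imports "HOL-Analysis.Analysis"
begin

section \<open>Nonempty compact subsets with the Hausdorff metric\<close>

definition compacts :: "'a::metric_space set \<Rightarrow> 'a set set" where
  "compacts X = {K. K \<noteq> {} \<and> compact K \<and> K \<subseteq> X}"

text \<open>The value 0 off the nonempty compact sets is never used; it is there because
  the locale \<^locale>\<open>Metric_space\<close> asks for a distance that is nonnegative everywhere.\<close>

definition hausdist :: "'a::metric_space set \<Rightarrow> 'a set \<Rightarrow> real" where
  "hausdist A B =
    (if A \<in> compacts UNIV \<and> B \<in> compacts UNIV
     then max (SUP x\<in>A. infdist x B) (SUP y\<in>B. infdist y A) else 0)"

lemma hausdist_le_iff:
  assumes "A \<in> compacts UNIV" "B \<in> compacts UNIV"
  shows "hausdist A B \<le> c \<longleftrightarrow> (\<forall>x\<in>A. infdist x B \<le> c) \<and> (\<forall>y\<in>B. infdist y A \<le> c)"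
proof -
  have *: "(SUP x\<in>A. infdist x B) \<le> c \<longleftrightarrow> (\<forall>x\<in>A. infdist x B \<le> c)"
    if "A \<in> compacts UNIV" for A B :: "'a set"
  proof -
    have "compact ((\<lambda>x. infdist x B) ` A)"
      using that by (intro compact_continuous_image continuous_intros) (auto simp: compacts_def)
    then have "bdd_above ((\<lambda>x. infdist x B) ` A)"
      by (simp add: bounded_imp_bdd_above compact_imp_bounded)
    then show ?thesis
      using that by (subst cSUP_le_iff) (auto simp: compacts_def)
  qed
  show ?thesis
    using assms by (simp add: hausdist_def *)
qed

lemma Metric_space_hausdist: "Metric_space (compacts X) hausdist"
proof
  have nonneg: "0 \<le> hausdist A B" if "A \<in> compacts UNIV" "B \<in> compacts UNIV" for A B :: "'a set"
  proof -
    have "A \<noteq> {}" using that by (auto simp: compacts_def)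
    then obtain x where "x \<in> A" by blast
    then have "infdist x B \<le> hausdist A B" using hausdist_le_iff[OF that] by blast
    then show ?thesis using infdist_nonneg[of x B] by linarith
  qed
  show "0 \<le> hausdist A B" for A B :: "'a set"
    using nonneg[of A B] by (cases "A \<in> compacts UNIV \<and> B \<in> compacts UNIV") (auto simp: hausdist_def)
  show "hausdist A B = hausdist B A" for A B :: "'a set"
    by (auto simp: hausdist_def max.commute)
  have sub: "A \<in> compacts UNIV" if "A \<in> compacts X" for A
    using that by (auto simp: compacts_def)
  show "hausdist A B = 0 \<longleftrightarrow> A = B" if "A \<in> compacts X" "B \<in> compacts X" for A B
  proof -
    have AB: "A \<in> compacts UNIV" "B \<in> compacts UNIV" using that sub by auto
    have cl: "closed A" "closed B" "A \<noteq> {}" "B \<noteq> {}"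
      using AB by (auto simp: compacts_def compact_imp_closed)
    have z: "infdist x C \<le> 0 \<longleftrightarrow> x \<in> C" if "closed C" "C \<noteq> {}" for x and C :: "'a set"
      using in_closed_iff_infdist_zero[OF that] infdist_nonneg[of x C] by (metis antisym order_refl)
    have "hausdist A B = 0 \<longleftrightarrow> hausdist A B \<le> 0" using nonneg[OF AB] by linarith
    also have "\<dots> \<longleftrightarrow> A = B" using cl by (auto simp: hausdist_le_iff[OF AB] z)
    finally show ?thesis .
  qed
  show "hausdist A C \<le> hausdist A B + hausdist B C"
    if "A \<in> compacts X" "B \<in> compacts X" "C \<in> compacts X" for A B C
  proof -
    have U: "A \<in> compacts UNIV" "B \<in> compacts UNIV" "C \<in> compacts UNIV" using that sub by auto
    have *: "infdist x C \<le> hausdist A B + hausdist B C"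
      if "A \<in> compacts UNIV" "B \<in> compacts UNIV" "C \<in> compacts UNIV" "x \<in> A" for A B C and x :: 'a
    proof -
      have B: "compact B" "B \<noteq> {}" using that by (auto simp: compacts_def)
      have "continuous_on B (dist x)" by (intro continuous_intros)
      then obtain b where b': "b \<in> B" "\<forall>y\<in>B. dist x b \<le> dist x y"
        using continuous_attains_inf[OF B] by blast
      then have "dist x b \<le> infdist x B"
        using B by (auto simp: infdist_notempty intro: cINF_greatest)
      then have b: "b \<in> B" "infdist x B = dist x b"
        using b' by (auto intro: antisym infdist_le)
      have "infdist x C \<le> infdist b C + dist x b" by (rule infdist_triangle)
      moreover have "infdist b C \<le> hausdist B C" using hausdist_le_iff[OF that(2,3)] b by blast
      moreover have "infdist x B \<le> hausdist A B" using hausdist_le_iff[OF that(1,2)] that(4) by blast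
      ultimately show ?thesis using b by linarith
    qed
    have comm: "hausdist A B = hausdist B A" for A B :: "'a set"
      by (auto simp: hausdist_def max.commute)
    show ?thesis
      using *[OF U] *[OF U(3,2,1)] comm by (auto simp: hausdist_le_iff[OF U(1,3)] add.commute)
  qed
qed


section \<open>Configuration spaces\<close>

text \<open>An element of \<open>X\<^sup>M\<close> is an extensional function on \<^term>\<open>{..<M}\<close>, so composing it with a
  permutation of \<^term>\<open>{..<M}\<close> gives another one.\<close>

definition tuples :: "nat \<Rightarrow> 'a set \<Rightarrow> (nat \<Rightarrow> 'a) set" where
  "tuples M X = {..<M} \<rightarrow>\<^sub>E X"

definition perm_rel :: "nat \<Rightarrow> 'a set \<Rightarrow> ((nat \<Rightarrow> 'a) \<times> (nat \<Rightarrow> 'a)) set" where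
  "perm_rel M X = {(x, y). x \<in> tuples M X \<and> y \<in> tuples M X \<and> (\<exists>\<sigma>. \<sigma> permutes {..<M} \<and> y = x \<circ> \<sigma>)}"

definition config_space :: "nat \<Rightarrow> 'a set \<Rightarrow> (nat \<Rightarrow> 'a) set set" where
  "config_space M X = tuples M X // perm_rel M X"

definition perm_dist :: "nat \<Rightarrow> (nat \<Rightarrow> 'a::metric_space) \<Rightarrow> (nat \<Rightarrow> 'a) \<Rightarrow> real" where
  "perm_dist M x y = (MIN \<sigma>\<in>{\<sigma>. \<sigma> permutes {..<M}}. MAX j\<in>{..<M}. dist (x (\<sigma> j)) (y j))"

text \<open>\<^const>\<open>the_elem\<close> picks the common value of \<^const>\<open>perm_dist\<close> on all representatives (see
  \<open>config_dist_class\<close> below). Off the configuration space the value 0 is again irrelevant.\<close>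

definition config_dist ::
  "nat \<Rightarrow> 'a::metric_space set \<Rightarrow> (nat \<Rightarrow> 'a) set \<Rightarrow> (nat \<Rightarrow> 'a) set \<Rightarrow> real" where
  "config_dist M X P Q =
    (if P \<in> config_space M X \<and> Q \<in> config_space M X
     then the_elem (\<Union>x\<in>P. \<Union>y\<in>Q. {perm_dist M x y}) else 0)"

definition config_set :: "nat \<Rightarrow> (nat \<Rightarrow> 'a) set \<Rightarrow> 'a set" where
  "config_set M P = the_elem (\<Union>x\<in>P. {x ` {..<M}})"

lemma equiv_perm_rel: "equiv (tuples M X) (perm_rel M X)"
proof (rule equivI)
  show "perm_rel M X \<subseteq> tuples M X \<times> tuples M X"
    by (auto simp: perm_rel_def)
  show "refl_on (tuples M X) (perm_rel M X)"
    by (auto simp: refl_on_def perm_rel_def intro: exI[of _ id])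
  show "sym (perm_rel M X)"
  proof (rule symI)
    fix x y assume "(x, y) \<in> perm_rel M X"
    then obtain \<sigma> where s: "x \<in> tuples M X" "y \<in> tuples M X" "\<sigma> permutes {..<M}" "y = x \<circ> \<sigma>"
      by (auto simp: perm_rel_def)
    have "x = y \<circ> inv \<sigma>"
      using s(3,4) by (simp add: comp_assoc permutes_inv_o)
    then show "(y, x) \<in> perm_rel M X"
      using s permutes_inv[OF s(3)] unfolding perm_rel_def by blast
  qed
  show "trans (perm_rel M X)"
  proof (rule transI)
    fix x y z assume "(x, y) \<in> perm_rel M X" "(y, z) \<in> perm_rel M X"
    then obtain \<sigma> \<tau> where s: "x \<in> tuples M X" "z \<in> tuples M X" "\<sigma> permutes {..<M}" "y = x \<circ> \<sigma>"
      "\<tau> permutes {..<M}" "z = y \<circ> \<tau>"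
      by (auto simp: perm_rel_def)
    then have "z = x \<circ> (\<sigma> \<circ> \<tau>)" by (simp add: comp_assoc)
    then show "(x, z) \<in> perm_rel M X"
      using s permutes_compose[OF s(5,3)] unfolding perm_rel_def by blast
  qed
qed

lemma config_set_class:
  assumes "x \<in> tuples M X"
  shows "config_set M (perm_rel M X `` {x}) = x ` {..<M}"
  unfolding config_set_def
proof (rule UN_equiv_class[OF equiv_perm_rel _ assms, THEN arg_cong[of _ _ the_elem], THEN trans])
  have "(x \<circ> \<sigma>) ` {..<M} = x ` {..<M}" if "\<sigma> permutes {..<M}" for \<sigma> and x :: "nat \<Rightarrow> 'a"
    by (metis image_comp permutes_image that)
  then show "(\<lambda>x. {x ` {..<M}}) respects perm_rel M X"
    unfolding congruent_def perm_rel_def by fastforce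
qed simp

lemma perm_dist_le_iff:
  assumes "M > 0"
  shows "perm_dist M x y \<le> c \<longleftrightarrow> (\<exists>\<sigma>. \<sigma> permutes {..<M} \<and> (\<forall>j<M. dist (x (\<sigma> j)) (y j) \<le> c))"
proof -
  have fin: "finite {\<sigma>. \<sigma> permutes {..<M}}" "{\<sigma>. \<sigma> permutes {..<M}} \<noteq> {}"
    using permutes_id[of "{..<M}"] by (blast intro: finite_permutations)+
  have ne: "{..<M} \<noteq> {}" using assms by auto
  have "(MAX j\<in>{..<M}. dist (x (\<sigma> j)) (y j)) \<le> c \<longleftrightarrow> (\<forall>j<M. dist (x (\<sigma> j)) (y j) \<le> c)" for \<sigma>
    using ne by (subst Max_le_iff) auto
  then show ?thesis
    unfolding perm_dist_def using fin by (subst Min_le_iff) auto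
qed

lemma perm_dist_commute_le: "M > 0 \<Longrightarrow> perm_dist M y x \<le> perm_dist M x y"
proof -
  assume M: "M > 0"
  obtain \<sigma> where s: "\<sigma> permutes {..<M}" "\<forall>j<M. dist (x (\<sigma> j)) (y j) \<le> perm_dist M x y"
    using perm_dist_le_iff[OF M, of x y "perm_dist M x y"] by auto
  have "dist (y (inv \<sigma> j)) (x j) \<le> perm_dist M x y" if "j < M" for j
  proof -
    have "inv \<sigma> j < M" using permutes_in_image[OF permutes_inv[OF s(1)], of j] that by simp
    then show ?thesis using s(2) permutes_inverses(1)[OF s(1), of j] by (metis dist_commute)
  qed
  then show ?thesis
    using permutes_inv[OF s(1)] perm_dist_le_iff[OF M] by blast
qed

lemma perm_dist_commute: "M > 0 \<Longrightarrow> perm_dist M x y = perm_dist M y x"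
  by (simp add: antisym perm_dist_commute_le)

lemma perm_dist_triangle:
  assumes M: "M > 0"
  shows "perm_dist M x z \<le> perm_dist M x y + perm_dist M y z"
proof -
  obtain \<sigma> where s: "\<sigma> permutes {..<M}" "\<forall>j<M. dist (x (\<sigma> j)) (y j) \<le> perm_dist M x y"
    using perm_dist_le_iff[OF M, of x y "perm_dist M x y"] by auto
  obtain \<tau> where t: "\<tau> permutes {..<M}" "\<forall>j<M. dist (y (\<tau> j)) (z j) \<le> perm_dist M y z"
    using perm_dist_le_iff[OF M, of y z "perm_dist M y z"] by auto
  have "dist (x ((\<sigma> \<circ> \<tau>) j)) (z j) \<le> perm_dist M x y + perm_dist M y z" if "j < M" for j
  proof -
    have "\<tau> j < M" using permutes_in_image[OF t(1), of j] that by simp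
    then have "dist (x (\<sigma> (\<tau> j))) (y (\<tau> j)) \<le> perm_dist M x y" using s by blast
    moreover have "dist (y (\<tau> j)) (z j) \<le> perm_dist M y z" using t that by blast
    ultimately show ?thesis using dist_triangle[of "x (\<sigma> (\<tau> j))" "z j" "y (\<tau> j)"] by simp
  qed
  then show ?thesis
    using permutes_compose[OF t(1) s(1)] perm_dist_le_iff[OF M] by blast
qed

lemma perm_dist_nonneg:
  assumes M: "M > 0"
  shows "0 \<le> perm_dist M x y"
proof -
  obtain \<sigma> where "\<forall>j<M. dist (x (\<sigma> j)) (y j) \<le> perm_dist M x y"
    using perm_dist_le_iff[OF M, of x y "perm_dist M x y"] by auto
  then have "dist (x (\<sigma> 0)) (y 0) \<le> perm_dist M x y" using M by blast
  then show ?thesis using zero_le_dist order_trans by blast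
qed

lemma perm_dist_eq_0_iff:
  assumes M: "M > 0" and "x \<in> tuples M X" "y \<in> tuples M X"
  shows "perm_dist M x y = 0 \<longleftrightarrow> (x, y) \<in> perm_rel M X"
proof -
  have *: "(\<forall>j<M. dist (x (\<sigma> j)) (y j) \<le> 0) \<longleftrightarrow> y = x \<circ> \<sigma>" if "\<sigma> permutes {..<M}" for \<sigma>
  proof -
    have "x (\<sigma> j) = y j" if "\<not> j < M" for j
      using that assms(2,3) permutes_not_in[OF \<open>\<sigma> permutes {..<M}\<close>, of j]
      by (auto simp: tuples_def PiE_def extensional_def)
    then show ?thesis unfolding fun_eq_iff by (metis comp_apply dist_le_zero_iff)
  qed
  have "perm_dist M x y = 0 \<longleftrightarrow> perm_dist M x y \<le> 0"
    using perm_dist_nonneg[OF M, of x y] by linarith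
  also have "\<dots> \<longleftrightarrow> (x, y) \<in> perm_rel M X"
    unfolding perm_dist_le_iff[OF M] using * assms by (auto simp: perm_rel_def)
  finally show ?thesis .
qed

lemma perm_dist_cong:
  assumes M: "M > 0" and "(x, x') \<in> perm_rel M X" "(y, y') \<in> perm_rel M X"
  shows "perm_dist M x y = perm_dist M x' y'"
proof -
  have 0: "perm_dist M x x' = 0" "perm_dist M y y' = 0"
    using assms perm_dist_eq_0_iff[OF M] by (auto simp: perm_rel_def)
  have 0: "perm_dist M x x' = 0" "perm_dist M y y' = 0" "perm_dist M x' x = 0" "perm_dist M y' y = 0"
    using 0 perm_dist_commute[OF M] by metis+
  have "perm_dist M x y \<le> perm_dist M x' y'"
    using perm_dist_triangle[OF M, of x y x'] perm_dist_triangle[OF M, of x' y y'] 0 by linarith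
  moreover have "perm_dist M x' y' \<le> perm_dist M x y"
    using perm_dist_triangle[OF M, of x' y' x] perm_dist_triangle[OF M, of x y' y] 0 by linarith
  ultimately show ?thesis by simp
qed

lemma config_dist_class:
  assumes "M > 0" "x \<in> tuples M X" "y \<in> tuples M X"
  shows "config_dist M X (perm_rel M X `` {x}) (perm_rel M X `` {y}) = perm_dist M x y"
proof -
  have "(\<Union>x'\<in>perm_rel M X `` {x}. \<Union>y'\<in>perm_rel M X `` {y}. {perm_dist M x' y'}) = {perm_dist M x y}"
    by (rule UN_equiv_class2[OF equiv_perm_rel equiv_perm_rel _ assms(2,3)])
       (auto simp: congruent2_def perm_dist_cong[OF assms(1)])
  then show ?thesis
    using assms by (simp add: config_dist_def config_space_def quotientI)
qed

lemma Metric_space_config_dist: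
  assumes M: "M > 0"
  shows "Metric_space (config_space M X) (config_dist M X)"
proof
  have rep: "\<exists>x. x \<in> tuples M X \<and> P = perm_rel M X `` {x}" if "P \<in> config_space M X" for P
    using that unfolding config_space_def by (auto elim: quotientE)
  have off: "config_dist M X P Q = 0" if "\<not> (P \<in> config_space M X \<and> Q \<in> config_space M X)" for P Q
    using that by (auto simp: config_dist_def)
  show "0 \<le> config_dist M X P Q" for P Q
    using off[of P Q] rep[of P] rep[of Q] perm_dist_nonneg[OF M] config_dist_class[OF M]
    by (metis order_refl)
  show "config_dist M X P Q = config_dist M X Q P" for P Q
    using off[of P Q] off[of Q P] rep[of P] rep[of Q] perm_dist_commute[OF M] config_dist_class[OF M]
    by metis
  show "config_dist M X P Q = 0 \<longleftrightarrow> P = Q" if "P \<in> config_space M X" "Q \<in> config_space M X" for P Q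
    using rep[OF that(1)] rep[OF that(2)] perm_dist_eq_0_iff[OF M] config_dist_class[OF M]
      eq_equiv_class_iff[OF equiv_perm_rel[of M X]] by metis
  show "config_dist M X P R \<le> config_dist M X P Q + config_dist M X Q R"
    if "P \<in> config_space M X" "Q \<in> config_space M X" "R \<in> config_space M X" for P Q R
    using rep[OF that(1)] rep[OF that(2)] rep[OF that(3)] perm_dist_triangle[OF M] config_dist_class[OF M]
    by metis
qed


section \<open>Games\<close>

text \<open>Probability measures on a finite set \<open>S\<close> of pure strategies. All players draw their pure
  strategies from one finite type, so that the simplex is a face of the standard simplex of
  \<^typ>\<open>real ^ 's\<close> and carries its Euclidean metric.\<close>

definition mixed_strategies :: "'s::finite set \<Rightarrow> (real ^ 's) set" where
  "mixed_strategies S = {x. (\<forall>s. 0 \<le> x $ s) \<and> (\<forall>s. s \<notin> S \<longrightarrow> x $ s = 0) \<and> (\<Sum>s\<in>S. x $ s) = 1}"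

text \<open>Players are \<^term>\<open>{1..N}\<close>, \<open>A j\<close> is the strategy space of player \<open>j\<close>, and \<open>r i x b\<close> is the cost
  for player \<open>i\<close> of playing \<open>x\<close> against \<open>b\<close>. A profile is an extensional function on \<^term>\<open>{1..N}\<close>, so
  \<open>restrict a ({1..N} - {i})\<close> deletes the \<open>i\<close>-th entry of \<open>a\<close> and \<open>b(i := x)\<close> puts \<open>x\<close> back in.\<close>

definition profiles :: "nat \<Rightarrow> (nat \<Rightarrow> 'a set) \<Rightarrow> (nat \<Rightarrow> 'a) set" where
  "profiles N A = (\<Pi>\<^sub>E j\<in>{1..N}. A j)"

definition others :: "nat \<Rightarrow> (nat \<Rightarrow> 'a set) \<Rightarrow> nat \<Rightarrow> (nat \<Rightarrow> 'a) set" where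
  "others N A i = (\<Pi>\<^sub>E j\<in>{1..N} - {i}. A j)"

definition others_topology ::
  "nat \<Rightarrow> (nat \<Rightarrow> 'a::metric_space set) \<Rightarrow> nat \<Rightarrow> (nat \<Rightarrow> 'a) topology" where
  "others_topology N A i = product_topology (\<lambda>j. top_of_set (A j)) ({1..N} - {i})"

lemma topspace_others_topology: "topspace (others_topology N A i) = others N A i"
  by (simp add: others_topology_def others_def)

definition best_response ::
  "(nat \<Rightarrow> 'a set) \<Rightarrow> (nat \<Rightarrow> 'a \<Rightarrow> (nat \<Rightarrow> 'a) \<Rightarrow> real) \<Rightarrow> nat \<Rightarrow> (nat \<Rightarrow> 'a) \<Rightarrow> 'a set" where
  "best_response A r i b = {x. is_arg_min (\<lambda>y. r i y b) (\<lambda>y. y \<in> A i) x}"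

definition graph_in_profiles ::
  "nat \<Rightarrow> (nat \<Rightarrow> 'a set) \<Rightarrow> nat \<Rightarrow> ((nat \<Rightarrow> 'a) \<Rightarrow> 'a set) \<Rightarrow> (nat \<Rightarrow> 'a) set" where
  "graph_in_profiles N A i F = {b(i := x) | b x. b \<in> others N A i \<and> x \<in> F b}"

definition nash_equilibrium ::
  "nat \<Rightarrow> (nat \<Rightarrow> 'a set) \<Rightarrow> (nat \<Rightarrow> 'a \<Rightarrow> (nat \<Rightarrow> 'a) \<Rightarrow> real) \<Rightarrow> (nat \<Rightarrow> 'a) \<Rightarrow> bool" where
  "nash_equilibrium N A r a \<longleftrightarrow> a \<in> profiles N A \<and>
    (\<forall>i\<in>{1..N}. \<forall>x\<in>A i.
      r i (a i) (restrict a ({1..N} - {i})) \<le> r i x (restrict a ({1..N} - {i})))"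

definition subset_liftable ::
  "nat \<Rightarrow> (nat \<Rightarrow> 'a::metric_space set) \<Rightarrow> nat \<Rightarrow> nat \<Rightarrow> ((nat \<Rightarrow> 'a) \<Rightarrow> 'a set) \<Rightarrow> bool" where
  "subset_liftable N A i M F \<longleftrightarrow>
    (\<exists>g. continuous_map (others_topology N A i)
           (Metric_space.mtopology (config_space M (A i)) (config_dist M (A i))) g \<and>
         (\<forall>b\<in>others N A i. config_set M (g b) \<subseteq> F b))"

definition weakly_configurable ::
  "nat \<Rightarrow> (nat \<Rightarrow> 'a::metric_space set) \<Rightarrow> (nat \<Rightarrow> 'a \<Rightarrow> (nat \<Rightarrow> 'a) \<Rightarrow> real) \<Rightarrow> nat \<Rightarrow> bool" where
  "weakly_configurable N A r i \<longleftrightarrow>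
    (\<forall>\<epsilon>>0. \<exists>F. F \<in> others N A i \<rightarrow> compacts (A i) \<and>
      (\<exists>M>0. subset_liftable N A i M F) \<and>
      (\<forall>b\<in>others N A i. hausdist (best_response A r i b) (F b) < \<epsilon>))"

end

theory Submission
  imports Defs "Jordan_Normal_Form.Determinant"
begin

text \<open>The players' subset lifts combine into a map from a cube to multisets of points of the cube, one
  point for every choice of a sheet per player, and it suffices to find a point close to a point of its
  image: the distance of a profile to its best responses is continuous, so it attains its infimum over
  the compact set of profiles, and that infimum is then 0.

  Such a point comes from a branched Sperner lemma. Subdivide the cube into a fine grid and
  barycentrically subdivide the grid. Over a grid cell \<open>c\<close>, the points of the images of the vertices of
  \<open>c\<close> split into clusters (connect points at distance at most \<open>\<delta>\<close>); as the map is continuous, a cluster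
  contains equally many points over each vertex of \<open>c\<close>, and passing to a larger cell only merges
  clusters. Give each cluster the Kuhn label of one of its members. A flag of cells together with a
  point over its smallest cell then carries a sequence of labels, and the fully labelled ones, counted
  with orientation, number exactly the cardinality of the multisets, because the terms of the boundary
  expansion cancel in pairs as in Sperner's lemma. A parity count would not do, since this
  cardinality may be even. A fully labelled flag yields the approximate fixed point.\<close>

no_notation Matrix.vec_index (infixl "$" 100)

section \<open>Determinants of label sequences\<close>

definition label_mat :: "nat \<Rightarrow> (nat \<Rightarrow> nat) \<Rightarrow> int mat" where
  "label_mat n l = mat n n (\<lambda>(a, b). if l a = b then 1 else 0)"

lemma label_det_zero:
  assumes "b < n" "\<And>a. a < n \<Longrightarrow> l a \<noteq> b"
  shows "Determinant.det (label_mat n l) = 0"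
proof -
  have "Determinant.det (label_mat n l) = (\<Sum>i<n. label_mat n l $$ (i, b) * cofactor (label_mat n l) i b)"
    by (rule laplace_expansion_column) (use assms in \<open>auto simp: label_mat_def\<close>)
  also have "\<dots> = 0" 
    using assms by (intro sum.neutral) (auto simp: label_mat_def)
  finally show ?thesis .
qed

lemma label_mat_cong:
  assumes "\<And>a. a < n \<Longrightarrow> l a = l' a"
  shows "label_mat n l = label_mat n l'"
  using assms by (auto simp: label_mat_def)

text \<open>As all labels are at most \<open>n\<close>, the columns add up to the all-ones vector; the expansion is along
  the last column after replacing it by this sum.\<close>

lemma label_det_expand:
  assumes "\<And>a. a \<le> n \<Longrightarrow> l a \<le> n"
  shows "Determinant.det (label_mat (Suc n) l) =
    (\<Sum>k\<le>n. (-1) ^ (k + n) * Determinant.det (label_mat n (l \<circ> insert_index k)))"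
proof -
  define A where "A = label_mat (Suc n) l"
  define U :: "int mat" where "U = mat (Suc n) (Suc n) (\<lambda>(a, b). if a = b \<or> b = n then 1 else 0)"
  have A: "A \<in> carrier_mat (Suc n) (Suc n)" and U: "U \<in> carrier_mat (Suc n) (Suc n)"
    by (auto simp: A_def U_def label_mat_def)
  have "Determinant.det U = prod_list (diag_mat U)"
    by (rule det_upper_triangular[OF _ U]) (auto simp: U_def)
  also have "\<dots> = 1"
    by (subst prod_list_diag_prod) (simp add: U_def)
  finally have dU: "Determinant.det U = 1" .
  have ent: "(A * U) $$ (i, j) = (if j = n then 1 else A $$ (i, j))" if "i \<le> n" "j \<le> n" for i j
  proof -
    have "(A * U) $$ (i, j) = (\<Sum>b<Suc n. A $$ (i, b) * U $$ (b, j))"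
      using that A U by (simp add: scalar_prod_def lessThan_atLeast0)
    also have "\<dots> = (\<Sum>b<Suc n. if b = (if j = n then l i else j) then (if j = n then 1 else A $$ (i, j)) else 0)"
      using that by (intro sum.cong) (auto simp: A_def U_def label_mat_def)
    also have "\<dots> = (if j = n then 1 else A $$ (i, j))"
      using that assms[of i] by (subst sum.delta) auto
    finally show ?thesis .
  qed
  have "Determinant.det A = Determinant.det (A * U)"
    using det_mult[OF A U] dU by simp
  also have "\<dots> = (\<Sum>i<Suc n. (A * U) $$ (i, n) * cofactor (A * U) i n)"
    by (rule laplace_expansion_column) (use A U in auto)
  also have "\<dots> = (\<Sum>k<Suc n. (-1) ^ (k + n) * Determinant.det (label_mat n (l \<circ> insert_index k)))"
  proof (rule sum.cong[OF refl])
    fix k assume k: "k \<in> {..<Suc n}"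
    have "mat_delete (A * U) k n = label_mat n (l \<circ> insert_index k)"
    proof (rule eq_matI)
      fix i j assume "i < dim_row (label_mat n (l \<circ> insert_index k))" "j < dim_col (label_mat n (l \<circ> insert_index k))"
      then have ij: "i < n" "j < n" by (auto simp: label_mat_def)
      then have "mat_delete (A * U) k n $$ (i, j) = (A * U) $$ (insert_index k i, j)"
        using A U by (simp add: mat_delete_def insert_index_def)
      also have "\<dots> = A $$ (insert_index k i, j)"
        using ij ent[of "insert_index k i" j] by (auto simp: insert_index_def)
      finally show "mat_delete (A * U) k n $$ (i, j) = label_mat n (l \<circ> insert_index k) $$ (i, j)"
        using ij by (auto simp: A_def label_mat_def insert_index_def)
    qed (use A U in \<open>auto simp: label_mat_def mat_delete_def\<close>)
    then show "(A * U) $$ (k, n) * cofactor (A * U) k n =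
        (-1) ^ (k + n) * Determinant.det (label_mat n (l \<circ> insert_index k))"
      using k ent[of k n] by (simp add: cofactor_def)
  qed
  finally show ?thesis by (simp add: A_def lessThan_Suc_atMost)
qed

section \<open>A branched Sperner lemma\<close>

definition even_end :: "nat \<Rightarrow> nat" where "even_end x = (if even x then x else Suc x)"
definition odd_end :: "nat \<Rightarrow> nat" where "odd_end x = (if even x then Suc x else x)"

text \<open>Cells of the grid with vertices in \<open>{0, 2, \<dots>, 2p}\<^sup>m\<close> are encoded by their centres, so odd coordinates
  mark the directions of a cell. A flag of cells is a simplex in a unit cube of the refined
  grid, with lower corner \<open>h\<close>: the \<open>i\<close>-th coordinates move from the even to the odd end of \<open>[h i, h i + 1]\<close>,
  in the order given by \<open>\<pi>\<close>. In \<open>flags p n\<close> the coordinates from \<open>n\<close> on stay at \<open>2p\<close>, the even end of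
  \<open>[2p - 1, 2p]\<close>; this makes \<open>flags p n\<close> a subset of \<open>flags p (Suc n)\<close>.\<close>

definition flag_cell :: "(nat \<Rightarrow> nat) \<Rightarrow> (nat \<Rightarrow> nat) \<Rightarrow> nat \<Rightarrow> nat \<Rightarrow> nat" where
  "flag_cell h \<pi> k = (\<lambda>i. if i \<in> \<pi> ` {..<k} then odd_end (h i) else even_end (h i))"

definition flags :: "nat \<Rightarrow> nat \<Rightarrow> ((nat \<Rightarrow> nat) \<times> (nat \<Rightarrow> nat)) set" where
  "flags p n = {h. \<forall>i. (i \<in> {..<n} \<longrightarrow> h i \<in> {..<2 * p}) \<and> (i \<notin> {..<n} \<longrightarrow> h i = 2 * p - 1)} \<times>
     {\<pi>. \<pi> permutes {..<n}}"

definition flag_sign :: "nat \<Rightarrow> (nat \<Rightarrow> nat) \<times> (nat \<Rightarrow> nat) \<Rightarrow> int" where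
  "flag_sign n = (\<lambda>(h, \<pi>). sign \<pi> * (\<Prod>i<n. (- 1) ^ Suc (h i)))"

definition is_vertex :: "(nat \<Rightarrow> nat) \<Rightarrow> (nat \<Rightarrow> nat) \<Rightarrow> bool" where
  "is_vertex c v \<longleftrightarrow> (\<forall>i. even (v i) \<and> v i \<le> c i + 1 \<and> c i \<le> v i + 1)"

definition grid_cell :: "nat \<Rightarrow> nat \<Rightarrow> (nat \<Rightarrow> nat) \<Rightarrow> bool" where
  "grid_cell p m c \<longleftrightarrow> (\<forall>i. c i \<le> 2 * p \<and> (m \<le> i \<longrightarrow> c i = 2 * p))"

lemma finite_flags: "finite (flags p n)"
  unfolding flags_def by (intro finite_cartesian_product finite_set_of_finite_funs finite_permutations) auto

lemma sum_antisymmetric_eq_0: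
  fixes w :: "'a \<Rightarrow> int"
  assumes "\<And>x. x \<in> F \<Longrightarrow> \<tau> x \<in> F" "\<And>x. x \<in> F \<Longrightarrow> \<tau> (\<tau> x) = x" "\<And>x. x \<in> F \<Longrightarrow> w (\<tau> x) = - w x"
  shows "sum w F = 0"
proof -
  have "sum w F = sum (\<lambda>x. - w x) F"
    by (rule sum.reindex_bij_witness[of _ \<tau> \<tau>]) (use assms in auto)
  then show ?thesis by (simp add: sum_negf)
qed

lemma permutes_image_lessThan:
  fixes n k :: nat
  assumes "\<pi> permutes {..<n}" "k \<le> n"
  shows "\<pi> ` {..<k} \<subseteq> {..<n}"
proof -
  have "\<pi> ` {..<k} \<subseteq> \<pi> ` {..<n}" using assms(2) by (intro image_mono) auto
  then show ?thesis by (simp only: permutes_image[OF assms(1)])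
qed

lemma is_vertex_flag_cell: "is_vertex (flag_cell h \<pi> k) (flag_cell h \<pi> 0)"
  by (auto simp: is_vertex_def flag_cell_def even_end_def odd_end_def)

lemma grid_cell_flag_cell:
  assumes "(h, \<pi>) \<in> flags p n" "n \<le> m" "k \<le> n" "p > 0"
  shows "grid_cell p m (flag_cell h \<pi> k)"
  unfolding grid_cell_def
proof (intro allI conjI impI)
  fix i
  have h: "i < n \<Longrightarrow> h i < 2 * p" "i \<ge> n \<Longrightarrow> h i = 2 * p - 1" using assms by (auto simp: flags_def)
  show "flag_cell h \<pi> k i \<le> 2 * p"
    using h assms(4) by (cases "i < n") (auto simp: flag_cell_def even_end_def odd_end_def)
  assume "m \<le> i"
  then have "i \<notin> \<pi> ` {..<k}" using assms permutes_image_lessThan[of \<pi> n k] by (auto simp: flags_def)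
  then show "flag_cell h \<pi> k i = 2 * p" using h \<open>m \<le> i\<close> assms by (auto simp: flag_cell_def even_end_def)
qed

lemma prod_sign_update:
  fixes h :: "nat \<Rightarrow> nat"
  assumes "i < n" "even x \<noteq> even (h i)"
  shows "(\<Prod>k<n. (- 1 :: int) ^ Suc ((h(i := x)) k)) = - (\<Prod>k<n. (- 1) ^ Suc (h k))"
proof -
  have split: "prod g {..<n} = g i * prod g ({..<n} - {i})" for g :: "nat \<Rightarrow> int"
    using assms(1) by (intro prod.remove) auto
  have "(\<Prod>k\<in>{..<n} - {i}. (- 1 :: int) ^ Suc ((h(i := x)) k)) = (\<Prod>k\<in>{..<n} - {i}. (- 1) ^ Suc (h k))"
    by (intro prod.cong) auto
  moreover have "(- 1 :: int) ^ Suc ((h(i := x)) i) = - ((- 1) ^ Suc (h i))"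
    using assms(2) by (cases "even x") auto
  ultimately show ?thesis
    by (simp only: split mult_minus_left)
qed

lemma flag_sign_update:
  assumes "i < n" "even x \<noteq> even (h i)"
  shows "flag_sign n (h(i := x), \<pi>) = - flag_sign n (h, \<pi>)"
  using prod_sign_update[of i n x h, OF assms] by (simp add: flag_sign_def del: power_Suc)

text \<open>\<open>L c v j\<close> is the label over the cell \<open>c\<close> of the cluster containing the \<open>j\<close>-th point over the vertex \<open>v\<close>.
  Numberings of the points over two vertices are only related by a bijection depending on the pair.\<close>

locale branched_labelling =
  fixes p m :: nat and J :: "'j set" and L :: "(nat \<Rightarrow> nat) \<Rightarrow> (nat \<Rightarrow> nat) \<Rightarrow> 'j \<Rightarrow> nat"
  assumes p_pos: "p > 0"
    and label_le: "\<And>c v j. L c v j \<le> m"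
    and label_bottom: "\<And>c v j i. \<lbrakk>grid_cell p m c; is_vertex c v; j \<in> J; i < m; c i = 0\<rbrakk> \<Longrightarrow> L c v j \<noteq> i"
    and label_top: "\<And>c v j i. \<lbrakk>grid_cell p m c; is_vertex c v; j \<in> J; i < m; c i = 2 * p\<rbrakk> \<Longrightarrow> L c v j \<le> i"
    and matching: "\<And>e v v'. \<lbrakk>grid_cell p m e; is_vertex e v; is_vertex e v'\<rbrakk> \<Longrightarrow>
      \<exists>\<beta>. bij_betw \<beta> J J \<and> (\<forall>j\<in>J. \<forall>c. grid_cell p m c \<longrightarrow> is_vertex c v \<longrightarrow> is_vertex c v' \<longrightarrow>
        L c v j = L c v' (\<beta> j))"
begin

definition flag_label :: "(nat \<Rightarrow> nat) \<times> (nat \<Rightarrow> nat) \<Rightarrow> 'j \<Rightarrow> nat \<Rightarrow> nat" where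
  "flag_label = (\<lambda>(h, \<pi>) j a. L (flag_cell h \<pi> a) (flag_cell h \<pi> 0) j)"

definition full_count :: "nat \<Rightarrow> int" where
  "full_count n = (\<Sum>f\<in>flags p n. flag_sign n f * (\<Sum>j\<in>J. Determinant.det (label_mat (Suc n) (flag_label f j))))"

definition face_count :: "nat \<Rightarrow> nat \<Rightarrow> int" where
  "face_count n k = (\<Sum>f\<in>flags p n. flag_sign n f *
     (\<Sum>j\<in>J. Determinant.det (label_mat n (flag_label f j \<circ> insert_index k))))"

lemma flag_label_le:
  assumes "f \<in> flags p n" "n \<le> m" "a \<le> n" "j \<in> J"
  shows "flag_label f j a \<le> n"
proof (cases "n = m")
  case True then show ?thesis using label_le by (auto simp: flag_label_def split: prod.split)
next
  case False
  obtain h \<pi> where f: "f = (h, \<pi>)" by (cases f)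
  have "flag_cell h \<pi> a n = 2 * p"
    using assms p_pos permutes_image_lessThan[of \<pi> n a] unfolding f
    by (auto simp: flag_cell_def flags_def even_end_def)
  then show ?thesis
    using label_top[OF grid_cell_flag_cell is_vertex_flag_cell] assms False p_pos by (auto simp: f flag_label_def)
qed

lemma full_count_eq_face_counts:
  assumes "n \<le> m"
  shows "full_count n = (\<Sum>k\<le>n. (- 1) ^ (k + n) * face_count n k)"
proof -
  have "full_count n = (\<Sum>f\<in>flags p n. flag_sign n f * (\<Sum>j\<in>J. \<Sum>k\<le>n. (-1) ^ (k + n) *
      Determinant.det (label_mat n (flag_label f j \<circ> insert_index k))))"
    unfolding full_count_def
    by (intro sum.cong refl arg_cong2[of _ _ _ _ "(*)"] label_det_expand flag_label_le assms) auto
  also have "\<dots> = (\<Sum>f\<in>flags p n. \<Sum>k\<le>n. \<Sum>j\<in>J. (-1) ^ (k + n) * (flag_sign n f *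
      Determinant.det (label_mat n (flag_label f j \<circ> insert_index k))))"
    by (subst (2) sum.swap) (simp add: sum_distrib_left mult_ac)
  also have "\<dots> = (\<Sum>k\<le>n. (- 1) ^ (k + n) * face_count n k)"
    by (subst sum.swap) (simp add: face_count_def sum_distrib_left)
  finally show ?thesis .
qed

lemma face_count_first:
  assumes "n \<le> m" "n > 0"
  shows "face_count n 0 = 0"
  unfolding face_count_def
proof (rule sum_antisymmetric_eq_0)
  let ?r = "\<lambda>x::nat. if even x then Suc x else x - 1"
  let ?\<tau> = "\<lambda>(h :: nat \<Rightarrow> nat, \<pi> :: nat \<Rightarrow> nat). (h(\<pi> 0 := ?r (h (\<pi> 0))), \<pi>)"
  fix f assume "f \<in> flags p n"
  then obtain h \<pi> where f: "f = (h, \<pi>)" "(h, \<pi>) \<in> flags p n" by (cases f) auto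
  then have i: "\<pi> 0 < n" using assms permutes_in_image[of \<pi> "{..<n}" 0] by (auto simp: flags_def)
  have hi: "h (\<pi> 0) < 2 * p" using f i by (auto simp: flags_def)
  have "even (h (\<pi> 0)) \<Longrightarrow> Suc (h (\<pi> 0)) < 2 * p" using hi by presburger
  then show mem: "?\<tau> f \<in> flags p n"
    using f i hi by (auto simp: flags_def)
  show "?\<tau> (?\<tau> f) = f" by (auto simp: f fun_eq_iff)
  define h' where "h' = h(\<pi> 0 := ?r (h (\<pi> 0)))"
  have t: "?\<tau> f = (h', \<pi>)" by (simp add: f h'_def)
  have f': "(h', \<pi>) \<in> flags p n" using mem t by simp
  have sgn: "flag_sign n (?\<tau> f) = - flag_sign n f"
    unfolding t unfolding f(1) h'_def using i by (intro flag_sign_update) auto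
  have cells: "flag_cell h' \<pi> (Suc a) = flag_cell h \<pi> (Suc a)" for a
    by (auto simp: flag_cell_def h'_def fun_eq_iff odd_end_def even_end_def)
  define v v' where "v = flag_cell h \<pi> 0" and "v' = flag_cell h' \<pi> 0"
  have v: "is_vertex (flag_cell h \<pi> (Suc a)) v" "is_vertex (flag_cell h \<pi> (Suc a)) v'" for a
    unfolding v_def v'_def using is_vertex_flag_cell cells by metis+
  have gc: "grid_cell p m (flag_cell h \<pi> (Suc a))" if "a < n" for a
    using grid_cell_flag_cell[OF f(2) assms(1) _ p_pos] that by simp
  obtain \<beta> where \<beta>: "bij_betw \<beta> J J" "\<And>j c. \<lbrakk>j \<in> J; grid_cell p m c; is_vertex c v; is_vertex c v'\<rbrakk> \<Longrightarrow>
        L c v j = L c v' (\<beta> j)"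
    using matching[OF gc[OF assms(2)] v] by blast
  have "(\<Sum>j\<in>J. Determinant.det (label_mat n (flag_label f j \<circ> insert_index 0))) =
    (\<Sum>j\<in>J. Determinant.det (label_mat n (flag_label (?\<tau> f) (\<beta> j) \<circ> insert_index 0)))"
    using \<beta>(2) v gc unfolding t unfolding f(1)
    by (intro sum.cong refl arg_cong[of _ _ Determinant.det] label_mat_cong)
      (auto simp: flag_label_def insert_index_def cells simp flip: v_def v'_def)
  also have "\<dots> = (\<Sum>j\<in>J. Determinant.det (label_mat n (flag_label (?\<tau> f) j \<circ> insert_index 0)))"
    by (rule sum.reindex_bij_betw[OF \<beta>(1)])
  finally show "flag_sign n (?\<tau> f) * (\<Sum>j\<in>J. Determinant.det (label_mat n (flag_label (?\<tau> f) j \<circ> insert_index 0)))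
    = - (flag_sign n f * (\<Sum>j\<in>J. Determinant.det (label_mat n (flag_label f j \<circ> insert_index 0))))"
    by (simp add: sgn)
qed

lemma face_count_middle:
  assumes "0 < k" "k < n"
  shows "face_count n k = 0"
  unfolding face_count_def
proof (rule sum_antisymmetric_eq_0)
  let ?t = "Transposition.transpose (k - 1) k"
  let ?\<tau> = "\<lambda>(h :: nat \<Rightarrow> nat, \<pi> :: nat \<Rightarrow> nat). (h, \<pi> \<circ> ?t)"
  fix f assume "f \<in> flags p n"
  then obtain h \<pi> where f: "f = (h, \<pi>)" "(h, \<pi>) \<in> flags p n" by (cases f) auto
  then have \<pi>: "\<pi> permutes {..<n}" by (auto simp: flags_def)
  have t: "?t permutes {..<n}" using assms by (intro permutes_swap_id) auto
  show "?\<tau> f \<in> flags p n" using f permutes_compose[OF t \<pi>] by (auto simp: flags_def)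
  show "?\<tau> (?\<tau> f) = f" by (simp add: f comp_assoc)
  have "sign (\<pi> \<circ> ?t) = - sign \<pi>"
    using t \<pi> assms by (subst sign_compose) (auto simp: permutation_permutes sign_swap_id)
  then have sgn: "flag_sign n (?\<tau> f) = - flag_sign n f" by (simp add: f flag_sign_def)
  have img: "?t ` {..<a} = {..<a}" if "a \<noteq> k" for a
  proof (cases "a < k")
    case True
    have "?t x = x" if "x < a" for x
      using True that by (intro Transposition.transpose_apply_other) auto
    then show ?thesis by force
  next
    case False
    then have "?t permutes {..<a}" using that assms by (intro permutes_swap_id) auto
    then show ?thesis by (rule permutes_image)
  qed
  have cells: "flag_cell h (\<pi> \<circ> ?t) a = flag_cell h \<pi> a" if "a \<noteq> k" for a
    by (simp only: flag_cell_def image_comp[symmetric] img[OF that])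
  have "(\<Sum>j\<in>J. Determinant.det (label_mat n (flag_label (?\<tau> f) j \<circ> insert_index k)))
     = (\<Sum>j\<in>J. Determinant.det (label_mat n (flag_label f j \<circ> insert_index k)))"
    using assms
    by (intro sum.cong refl arg_cong[of _ _ Determinant.det] label_mat_cong)
      (auto simp: f flag_label_def insert_index_def cells simp del: One_nat_def)
  then show "flag_sign n (?\<tau> f) * (\<Sum>j\<in>J. Determinant.det (label_mat n (flag_label (?\<tau> f) j \<circ> insert_index k)))
    = - (flag_sign n f * (\<Sum>j\<in>J. Determinant.det (label_mat n (flag_label f j \<circ> insert_index k))))"
    unfolding sgn by simp
qed

lemma face_count_last:
  assumes "Suc q \<le> m"
  shows "face_count (Suc q) (Suc q) = full_count q"
proof -
  let ?n = "Suc q"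
  define w where "w f = flag_sign ?n f * (\<Sum>j\<in>J. Determinant.det (label_mat ?n (flag_label f j)))" for f
  define I where "I = {(h, \<pi>). (h, \<pi>) \<in> flags p ?n \<and> h (\<pi> q) \<noteq> 0 \<and> h (\<pi> q) \<noteq> 2 * p - 1}"
  have I: "I \<subseteq> flags p ?n" by (auto simp: I_def)
  have fc: "face_count ?n ?n = sum w (flags p ?n)"
    unfolding face_count_def w_def
    by (intro sum.cong refl arg_cong2[of _ _ _ _ "(*)"] arg_cong[of _ _ Determinant.det] label_mat_cong)
      (auto simp: insert_index_def)
  have "sum w I = 0"
  proof (rule sum_antisymmetric_eq_0)
    let ?r = "\<lambda>x::nat. if even x then x - 1 else Suc x"
    let ?\<tau> = "\<lambda>(h :: nat \<Rightarrow> nat, \<pi> :: nat \<Rightarrow> nat). (h(\<pi> q := ?r (h (\<pi> q))), \<pi>)"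
    fix f assume "f \<in> I"
    then obtain h \<pi> where f: "f = (h, \<pi>)" "(h, \<pi>) \<in> flags p ?n" "h (\<pi> q) \<noteq> 0" "h (\<pi> q) \<noteq> 2 * p - 1"
      by (auto simp: I_def)
    then have \<pi>: "\<pi> permutes {..<?n}" by (auto simp: flags_def)
    then have i: "\<pi> q < ?n" using permutes_in_image[of \<pi> "{..<?n}" q] by auto
    have hi: "h (\<pi> q) < 2 * p" using f i by (auto simp: flags_def)
    have r_range: "?r x < 2 * p \<and> ?r x \<noteq> 0 \<and> ?r x \<noteq> 2 * p - 1" if "x < 2 * p" "x \<noteq> 0" "x \<noteq> 2 * p - 1" for x
    proof (cases "even x")
      case True
      then have "x \<noteq> 1" by auto
      then show ?thesis using that True by auto
    next
      case False
      have "odd (2 * p - 1)" using p_pos by auto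
      with False have "Suc x \<noteq> 2 * p - 1" by (metis even_Suc)
      then show ?thesis using that False by auto
    qed
    define y where "y = ?r (h (\<pi> q))"
    have y: "y < 2 * p" "y \<noteq> 0" "y \<noteq> 2 * p - 1"
      unfolding y_def using r_range[OF hi f(3,4)] by blast+
    have "(h(\<pi> q := y), \<pi>) \<in> I"
      using f(2) i y by (auto simp: flags_def I_def)
    then show mem: "?\<tau> f \<in> I" by (simp only: f(1) y_def prod.case)
    show "?\<tau> (?\<tau> f) = f" using f(3) by (auto simp: f(1) fun_eq_iff)
    define h' where "h' = h(\<pi> q := y)"
    have t: "?\<tau> f = (h', \<pi>)" by (simp only: f(1) h'_def y_def prod.case)
    have par: "even y \<noteq> even (h (\<pi> q))" and ee: "even_end y = even_end (h (\<pi> q))"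
      using f(3) by (auto simp: y_def even_end_def)
    have sgn: "flag_sign ?n (?\<tau> f) = - flag_sign ?n f"
      unfolding t unfolding f(1) h'_def using i par by (rule flag_sign_update)
    have cells: "flag_cell h' \<pi> a = flag_cell h \<pi> a" if "a < ?n" for a
    proof -
      have "\<pi> q \<notin> \<pi> ` {..<a}" using that by (simp add: inj_image_mem_iff[OF permutes_inj[OF \<pi>]])
      then show ?thesis using ee by (simp add: flag_cell_def h'_def fun_eq_iff)
    qed
    have "(\<Sum>j\<in>J. Determinant.det (label_mat ?n (flag_label (?\<tau> f) j)))
     = (\<Sum>j\<in>J. Determinant.det (label_mat ?n (flag_label f j)))"
      unfolding t unfolding f(1)
      by (intro sum.cong refl arg_cong[of _ _ Determinant.det] label_mat_cong)
        (auto simp: flag_label_def cells)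
    then show "w (?\<tau> f) = - w f"
      unfolding w_def sgn by simp
  qed
  then have "sum w (flags p ?n) = sum w (flags p ?n - I)"
    using sum.subset_diff[OF I finite_flags, of w] by simp
  also have "\<dots> = full_count q"
    unfolding full_count_def
  proof (rule sum.mono_neutral_cong_right)
    show "finite (flags p ?n - I)" by (simp add: finite_flags)
    show "flags p q \<subseteq> flags p ?n - I"
    proof
      fix f assume "f \<in> flags p q"
      then obtain h \<pi> where f: "f = (h, \<pi>)" "(h, \<pi>) \<in> flags p q" by (cases f) auto
      then have \<pi>: "\<pi> permutes {..<q}" by (auto simp: flags_def)
      then have "\<pi> q = q" by (auto intro: permutes_not_in)
      moreover have "\<pi> permutes {..<?n}" using \<pi> by (rule permutes_subset) auto
      ultimately show "f \<in> flags p ?n - I" using f p_pos by (auto simp: flags_def I_def less_Suc_eq)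
    qed
    show "w f = flag_sign q f * (\<Sum>j\<in>J. Determinant.det (label_mat ?n (flag_label f j)))" if "f \<in> flags p q" for f
    proof -
      have "flag_sign ?n f = flag_sign q f" 
        using that p_pos by (auto simp: flag_sign_def flags_def)
      then show ?thesis by (simp add: w_def)
    qed
    show "\<forall>f\<in>flags p ?n - I - flags p q. w f = 0"
    proof
      fix f assume f0: "f \<in> flags p ?n - I - flags p q"
      then obtain h \<pi> where f: "f = (h, \<pi>)" "(h, \<pi>) \<in> flags p ?n" "(h, \<pi>) \<notin> flags p q"
        and h: "h (\<pi> q) = 0 \<or> h (\<pi> q) = 2 * p - 1" by (cases f) (auto simp: I_def)
      then have \<pi>: "\<pi> permutes {..<?n}" by (auto simp: flags_def)
      then have i: "\<pi> q < ?n" using permutes_in_image[of \<pi> "{..<?n}" q] by auto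
      have "flag_cell h \<pi> a (\<pi> q) = even_end (h (\<pi> q))" if "a < ?n" for a
      proof -
        have "\<pi> q \<notin> \<pi> ` {..<a}" using that by (simp add: inj_image_mem_iff[OF permutes_inj[OF \<pi>]])
        then show ?thesis by (simp add: flag_cell_def)
      qed
      note c = this
      note gc = grid_cell_flag_cell[OF f(2) assms _ p_pos] 
      have "\<exists>b<?n. \<forall>a<?n. flag_label f j a \<noteq> b" if j: "j \<in> J" for j
        using h
      proof
        assume "h (\<pi> q) = 0"
        then have "flag_label f j a \<noteq> \<pi> q" if "a < ?n" for a
          using label_bottom[OF gc is_vertex_flag_cell j, of a "\<pi> q"] c[OF that] that i assms
          by (auto simp: f flag_label_def even_end_def)
        then show ?thesis using i by blast
      next
        assume top: "h (\<pi> q) = 2 * p - 1"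
        have "\<pi> q \<noteq> q"
        proof
          assume eq: "\<pi> q = q"
          have "\<pi> permutes {..<q}"
            by (rule permutes_superset[OF \<pi>]) (use eq in \<open>auto simp: less_Suc_eq\<close>)
          then show False using f(2,3) top eq by (auto simp: flags_def less_Suc_eq not_less_eq)        qed
        then have iq: "\<pi> q < q" using i by simp
        have "flag_label f j a \<noteq> q" if "a < ?n" for a
          using label_top[OF gc is_vertex_flag_cell j, of a "\<pi> q"] c[OF that] that i assms top p_pos iq
          by (auto simp: f flag_label_def even_end_def)
        then show ?thesis by blast
      qed
      then have "Determinant.det (label_mat ?n (flag_label f j)) = 0" if "j \<in> J" for j
        using that label_det_zero by metis
      then show "w f = 0" by (simp add: w_def)
    qed
  qed
  finally show ?thesis using fc by simp
qed

lemma full_count_eq_card: "n \<le> m \<Longrightarrow> full_count n = int (card J)"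
proof (induction n)
  case 0
  have "flags p 0 = {(\<lambda>i. 2 * p - 1, id)}" by (auto simp: flags_def)
  moreover have "Determinant.det (label_mat (Suc 0) (flag_label (\<lambda>i. 2 * p - 1, id) j)) = 1" if "j \<in> J" for j
  proof -
    have "flag_label (\<lambda>i. 2 * p - 1, id) j 0 = 0"
      using flag_label_le[of "(\<lambda>i. 2 * p - 1, id)" 0 0 j] that by (auto simp: calculation)
    then show ?thesis by (simp add: det_single label_mat_def)
  qed
  ultimately show ?case by (simp add: full_count_def flag_sign_def)
next
  case (Suc q)
  have "full_count (Suc q) = (\<Sum>k\<le>Suc q. (- 1) ^ (k + Suc q) * face_count (Suc q) k)"
    by (rule full_count_eq_face_counts[OF Suc.prems])
  also have "\<dots> = (\<Sum>k\<in>{Suc q}. (- 1) ^ (k + Suc q) * face_count (Suc q) k)"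
  proof (rule sum.mono_neutral_right)
    show "\<forall>k\<in>{..Suc q} - {Suc q}. (- 1) ^ (k + Suc q) * face_count (Suc q) k = 0"
    proof
      fix k assume "k \<in> {..Suc q} - {Suc q}"
      then show "(- 1) ^ (k + Suc q) * face_count (Suc q) k = 0"
        using face_count_first[OF Suc.prems] face_count_middle[of k "Suc q"] by (cases "k = 0") auto
    qed
  qed auto
  also have "\<dots> = full_count q" using face_count_last[OF Suc.prems] by (simp flip: mult_2)
  finally show ?case using Suc by simp
qed

theorem full_flag_exists:
  assumes "finite J" "J \<noteq> {}"
  shows "\<exists>f\<in>flags p m. \<exists>j\<in>J. {..m} \<subseteq> flag_label f j ` {..m}"
proof (rule ccontr)
  assume neg: "\<not> ?thesis"
  have "Determinant.det (label_mat (Suc m) (flag_label f j)) = 0" if fj: "f \<in> flags p m" "j \<in> J" for f j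
  proof -
    obtain b where "b \<le> m" "b \<notin> flag_label f j ` {..m}" using neg fj by blast
    then show ?thesis by (intro label_det_zero[of b]) auto
  qed
  then have "full_count m = 0" by (simp add: full_count_def)
  then show False using full_count_eq_card[of m] assms by simp
qed

end

section \<open>Approximate fixed points on the cube\<close>

lemma relpow_dist_le:
  fixes d :: "'a \<Rightarrow> 'a \<Rightarrow> real"
  assumes "\<And>x. d x x \<le> 0" "\<And>x y z. d x z \<le> d x y + d y z" "\<And>x y. (x, y) \<in> R \<Longrightarrow> d x y \<le> \<delta>"
    and "(x, y) \<in> R ^^ k"
  shows "d x y \<le> real k * \<delta>"
  using assms(4)
proof (induction k arbitrary: y)
  case 0 then show ?case using assms(1) by simp
next
  case (Suc k)
  then obtain z where z: "(x, z) \<in> R ^^ k" "(z, y) \<in> R" by auto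
  have "d x y \<le> d x z + d z y" by (rule assms(2))
  also have "\<dots> \<le> real k * \<delta> + \<delta>" using Suc.IH[OF z(1)] assms(3)[OF z(2)] by linarith
  finally show ?case by (simp add: algebra_simps)
qed

lemma card_vertices_le:
  assumes "grid_cell p m c"
  shows "finite {v. is_vertex c v}" "card {v. is_vertex c v} \<le> 2 ^ m"
proof -
  let ?f = "\<lambda>B i. if odd (c i) then (if i \<in> B then c i + 1 else c i - 1) else c i"
  have sub: "{v. is_vertex c v} \<subseteq> ?f ` Pow {..<m}"
  proof
    fix v assume "v \<in> {v. is_vertex c v}"
    then have v: "even (v i)" "v i \<le> c i + 1" "c i \<le> v i + 1" for i by (auto simp: is_vertex_def)
    have "v = ?f {i. i < m \<and> v i = c i + 1}"
    proof
      fix i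
      have "even (c i)" if "\<not> i < m" using that assms by (auto simp: grid_cell_def)
      moreover have "v i = c i" if "even (c i)"
        using v[of i] that by presburger
      moreover have "v i = c i + 1 \<or> v i = c i - 1" if "odd (c i)"
        using v[of i] that by presburger
      ultimately show "v i = ?f {i. i < m \<and> v i = c i + 1} i" by auto
    qed
    then show "v \<in> ?f ` Pow {..<m}" by (rule image_eqI) auto
  qed
  then show "finite {v. is_vertex c v}" by (rule finite_subset) auto
  have "card {v. is_vertex c v} \<le> card (?f ` Pow {..<m})" using sub by (intro card_mono) auto
  also have "\<dots> \<le> card (Pow {..<m})" by (rule card_image_le) auto
  finally show "card {v. is_vertex c v} \<le> 2 ^ m" by (simp add: card_Pow)
qed

definition grid_point :: "nat \<Rightarrow> (nat \<Rightarrow> nat) \<Rightarrow> nat \<Rightarrow> real" where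
  "grid_point p v i = real (v i) / real (2 * p)"

lemma Least_le_bound:
  fixes m :: nat
  defines "l \<equiv> \<lambda>P. LEAST i. i = m \<or> P i"
  shows "l P \<le> m" "l P < m \<Longrightarrow> P (l P)" "i < l P \<Longrightarrow> \<not> P i"
proof -
  show "l P \<le> m" unfolding l_def by (rule Least_le) simp
  have "l P = m \<or> P (l P)" unfolding l_def by (rule LeastI[of _ m]) simp
  then show "l P < m \<Longrightarrow> P (l P)" by auto
  show "i < l P \<Longrightarrow> \<not> P i" unfolding l_def using not_less_Least[of i "\<lambda>i. i = m \<or> P i"] by blast
qed

lemma approx_fixed_point_grid:
  fixes Y :: "(nat \<Rightarrow> real) \<Rightarrow> 'j \<Rightarrow> nat \<Rightarrow> real" and p m :: nat
  assumes J: "finite J" "J \<noteq> {}" and p: "p > 0"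
    and range: "\<And>x j i. \<lbrakk>\<And>i. x i \<in> {0..1}; j \<in> J; i < m\<rbrakk> \<Longrightarrow> Y x j i \<in> {0..1}"
    and near_match: "\<And>x x'. \<lbrakk>\<And>i. x i \<in> {0..1}; \<And>i. x' i \<in> {0..1}; \<And>i. \<bar>x i - x' i\<bar> \<le> 1 / p\<rbrakk> \<Longrightarrow>
      \<exists>\<beta>. bij_betw \<beta> J J \<and> (\<forall>j\<in>J. \<forall>i<m. \<bar>Y x j i - Y x' (\<beta> j) i\<bar> \<le> \<delta>)"
  shows "\<exists>x. (\<forall>i. x i \<in> {0..1}) \<and> (\<exists>j\<in>J. \<forall>i<m. \<bar>Y x j i - x i\<bar> \<le> 1 / p + real ((2 ^ m * card J)\<^sup>2) * \<delta>)"
proof -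
  \<comment> \<open>clusters are the classes of the equivalence relation \<open>(R c)\<^sup>*\<close>, and \<open>rep\<close> picks a member\<close>
  define V where "V c = {v. is_vertex c v} \<times> J" for c
  define R where "R c = {((v, j), (v', j')). (v, j) \<in> V c \<and> (v', j') \<in> V c \<and>
     (\<forall>i<m. \<bar>Y (grid_point p v) j i - Y (grid_point p v') j' i\<bar> \<le> \<delta>)}" for c
  define rep where "rep c q = (SOME q'. q' \<in> (R c)\<^sup>* `` {q})" for c q
  define down where "down q i \<longleftrightarrow> Y (grid_point p (fst q)) (snd q) i < grid_point p (fst q) i \<or> fst q i = 2 * p"
    for q :: "(nat \<Rightarrow> nat) \<times> 'j" and i
  define L where "L c v j = (LEAST i. i = m \<or> down (rep c (v, j)) i)" for c v j
  have sub: "R c \<subseteq> V c \<times> V c" for c by (auto simp: R_def)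
  have sym: "sym (R c)" for c
    by (auto simp: R_def sym_def abs_minus_commute)
  have symrt: "sym ((R c)\<^sup>*)" for c by (rule sym_rtrancl[OF sym])
  have rep: "(q, rep c q) \<in> (R c)\<^sup>*" for c q
    unfolding rep_def using someI[of "\<lambda>q'. q' \<in> (R c)\<^sup>* `` {q}" q] by auto
  have repV: "rep c q \<in> V c" if "q \<in> V c" for c q
    using rep[of q c] that sub[of c] by (auto elim: rtranclE)
  have rep_eq: "rep c q = rep c q'" if "(q, q') \<in> R c" for c q q'
  proof -
    have "(R c)\<^sup>* `` {q} = (R c)\<^sup>* `` {q'}"
      using that symrt[of c] by (auto dest: symD intro: rtrancl_trans r_into_rtrancl converse_rtrancl_into_rtrancl)
    then show ?thesis by (simp add: rep_def)
  qed
  have gp: "grid_point p v i \<in> {0..1}" if "v i \<le> 2 * p" for v i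
    using that p by (auto simp: grid_point_def divide_le_eq simp flip: of_nat_mult)
  have vle: "v i \<le> 2 * p" if "grid_cell p m c" "is_vertex c v" for c v i
  proof -
    have "v i \<le> c i + 1" "c i \<le> 2 * p" "even (v i)" using that by (auto simp: is_vertex_def grid_cell_def)
    then show ?thesis by presburger
  qed
  have vx: "grid_point p v i \<in> {0..1}" if "grid_cell p m c" "is_vertex c v" for c v i
    using gp vle that by blast
  have near: "\<bar>grid_point p v i - grid_point p v' i\<bar> \<le> 1 / p" if "is_vertex c v" "is_vertex c v'" for c v v' i
  proof -
    have "v i \<le> c i + 1" "c i \<le> v i + 1" "v' i \<le> c i + 1" "c i \<le> v' i + 1"
      using that by (auto simp: is_vertex_def)
    then have "\<bar>real (v i) - real (v' i)\<bar> \<le> 2" by linarith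
    then have "\<bar>real (v i) - real (v' i)\<bar> / (2 * p) \<le> 2 / (2 * p)" by (rule divide_right_mono) simp
    then show ?thesis by (simp add: grid_point_def diff_divide_distrib[symmetric])
  qed
  have far: "\<bar>Y (grid_point p v) j i - Y (grid_point p w) l i\<bar> \<le> real ((2 ^ m * card J)\<^sup>2) * \<delta>"
    if far_asm: "grid_cell p m c" "((v, j), (w, l)) \<in> (R c)\<^sup>*" "i < m" "0 \<le> \<delta>" for c v j w l i
  proof -
    have fin: "finite (V c)" and cV: "card (V c) \<le> 2 ^ m * card J"
      using card_vertices_le[OF far_asm(1)] J by (auto simp: V_def card_cartesian_product)
    have finR: "finite (R c)" using sub fin by (meson finite_SigmaI finite_subset)
    have "card (R c) \<le> card (V c \<times> V c)" using sub fin by (intro card_mono) auto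
    also have "\<dots> \<le> (2 ^ m * card J)\<^sup>2"
      using cV by (simp add: card_cartesian_product power2_eq_square mult_le_mono)
    finally have cR: "card (R c) \<le> (2 ^ m * card J)\<^sup>2" .
    obtain k where k: "k \<le> card (R c)" "((v, j), (w, l)) \<in> R c ^^ k"
      using far_asm(2) rtrancl_finite_eq_relpow[OF finR] by auto
    have "\<bar>Y (grid_point p (fst (v, j))) (snd (v, j)) i - Y (grid_point p (fst (w, l))) (snd (w, l)) i\<bar> \<le> real k * \<delta>"
      by (rule relpow_dist_le[OF _ _ _ k(2)]) (use far_asm(3) in \<open>auto simp: R_def\<close>)
    also have "\<dots> \<le> real ((2 ^ m * card J)\<^sup>2) * \<delta>"
      using k(1) cR far_asm(4) by (intro mult_right_mono) (auto simp del: of_nat_power)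
    finally show ?thesis by simp
  qed
  interpret branched_labelling p m J L
  proof
    show "p > 0" by (rule p)
    show "L c v j \<le> m" for c v j unfolding L_def by (rule Least_le_bound)
    show "L c v j \<noteq> i"
      if "grid_cell p m c" "is_vertex c v" "j \<in> J" "i < m" "c i = 0" for c v j i
    proof
      assume "L c v j = i"
      then have d: "down (rep c (v, j)) i" using Least_le_bound(2)[of m "down (rep c (v, j))"] that(4)
        unfolding L_def by auto
      obtain w l where wl: "rep c (v, j) = (w, l)" by (cases "rep c (v, j)")
      have w: "is_vertex c w" "l \<in> J" using repV[of "(v, j)" c] that wl by (auto simp: V_def)
      then have "even (w i)" "w i \<le> 1" using that(5) by (auto simp: is_vertex_def dest: spec[of _ i])
      then have "w i = 0" by presburger
      then have "Y (grid_point p w) l i < 0" using d p by (simp add: wl down_def grid_point_def)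
      then show False using range[of "grid_point p w" l i] vx[OF that(1) w(1)] w(2) that(4) by force
    qed
    show "L c v j \<le> i"
      if "grid_cell p m c" "is_vertex c v" "j \<in> J" "i < m" "c i = 2 * p" for c v j i
    proof -
      obtain w l where wl: "rep c (v, j) = (w, l)" by (cases "rep c (v, j)")
      have w: "is_vertex c w" using repV[of "(v, j)" c] that wl by (auto simp: V_def)
      then have "2 * p \<le> w i + 1" "even (w i)" using that(5) by (auto simp: is_vertex_def dest: spec[of _ i])
      then have "w i = 2 * p" using vle[OF that(1) w, of i] by presburger
      then have "down (rep c (v, j)) i" by (simp add: wl down_def)
      then show ?thesis unfolding L_def by (intro Least_le) simp
    qed
    fix e v v' assume e: "grid_cell p m e" "is_vertex e v" "is_vertex e v'"
    have "\<exists>\<beta>. bij_betw \<beta> J J \<and>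
        (\<forall>j\<in>J. \<forall>i<m. \<bar>Y (grid_point p v) j i - Y (grid_point p v') (\<beta> j) i\<bar> \<le> \<delta>)"
      by (rule near_match) (rule vx[OF e(1,2)] vx[OF e(1,3)] near[OF e(2,3)])+
    then obtain \<beta> where \<beta>: "bij_betw \<beta> J J"
      "\<forall>j\<in>J. \<forall>i<m. \<bar>Y (grid_point p v) j i - Y (grid_point p v') (\<beta> j) i\<bar> \<le> \<delta>"
      by (elim exE conjE)
    have "L c v j = L c v' (\<beta> j)" if "j \<in> J" "is_vertex c v" "is_vertex c v'" for c j
    proof -
      have "((v, j), (v', \<beta> j)) \<in> R c"
        using that \<beta> by (auto simp: R_def V_def dest: bij_betwE)
      then show ?thesis by (simp add: L_def rep_eq)
    qed
    then show "\<exists>\<beta>. bij_betw \<beta> J J \<and> (\<forall>j\<in>J. \<forall>c. grid_cell p m c \<longrightarrow> is_vertex c v \<longrightarrow> is_vertex c v' \<longrightarrow>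
        L c v j = L c v' (\<beta> j))" using \<beta>(1) by blast
  qed
  obtain h \<pi> j where f: "(h, \<pi>) \<in> flags p m" and j: "j \<in> J" and full: "{..m} \<subseteq> flag_label (h, \<pi>) j ` {..m}"
    using full_flag_exists[OF J] by (metis surj_pair)
  define v where "v = flag_cell h \<pi> 0"
  let ?x = "grid_point p v"
  let ?K = "real ((2 ^ m * card J)\<^sup>2) * \<delta>"
  have v: "is_vertex (flag_cell h \<pi> k) v" for k unfolding v_def by (rule is_vertex_flag_cell)
  have gc: "grid_cell p m (flag_cell h \<pi> k)" if "k \<le> m" for k
    using grid_cell_flag_cell[OF f _ that p] by simp
  have x01: "?x i \<in> {0..1}" for i using vx[OF gc v, of 0] by simp
  have "\<bar>Y ?x j i - ?x i\<bar> \<le> 1 / p + ?K" if i: "i < m" for i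
  proof -
    have \<delta>: "0 \<le> \<delta>" 
    proof -
      have "\<exists>\<beta>. bij_betw \<beta> J J \<and> (\<forall>j\<in>J. \<forall>i<m. \<bar>Y ?x j i - Y ?x (\<beta> j) i\<bar> \<le> \<delta>)"
        by (rule near_match) (use x01 in auto)
      then show ?thesis using i j by (meson abs_ge_zero order_trans)
    qed
    have *: "\<exists>w l. is_vertex (flag_cell h \<pi> k) w \<and> l \<in> J \<and> \<bar>?x i - grid_point p w i\<bar> \<le> 1 / p \<and>
       \<bar>Y ?x j i - Y (grid_point p w) l i\<bar> \<le> ?K \<and> rep (flag_cell h \<pi> k) (v, j) = (w, l)" if k: "k \<le> m" for k
    proof -
      obtain w l where wl: "rep (flag_cell h \<pi> k) (v, j) = (w, l)" by (cases "rep (flag_cell h \<pi> k) (v, j)")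
      have "is_vertex (flag_cell h \<pi> k) w" "l \<in> J"
        using repV[of "(v, j)" "flag_cell h \<pi> k"] v j wl by (auto simp: V_def)
      then show ?thesis
        using near[OF v, of k w i] far[OF gc[OF k] _ i \<delta>, of v j w l] rep[of "(v, j)" "flag_cell h \<pi> k"] wl by auto
    qed
    have lab: "\<exists>k\<le>m. L (flag_cell h \<pi> k) v j = b" if "b \<le> m" for b
      
    proof -
      have "b \<in> flag_label (h, \<pi>) j ` {..m}" using full that by auto
      then show ?thesis by (auto simp: flag_label_def v_def)
    qed
    obtain k where k: "k \<le> m" "L (flag_cell h \<pi> k) v j = i" using lab[of i] i by auto
    obtain w l where w: "is_vertex (flag_cell h \<pi> k) w" "l \<in> J" "\<bar>?x i - grid_point p w i\<bar> \<le> 1 / p"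
       "\<bar>Y ?x j i - Y (grid_point p w) l i\<bar> \<le> ?K" "rep (flag_cell h \<pi> k) (v, j) = (w, l)"
      using *[OF k(1)] by blast
    have "down (w, l) i"
      using Least_le_bound(2)[of m "down (w, l)"] k(2) i w(5) unfolding L_def by auto
    then have "Y (grid_point p w) l i \<le> grid_point p w i"
    proof -
      have "Y (grid_point p w) l i \<in> {0..1}" by (rule range) (use vx[OF gc[OF k(1)] w(1)] w(2) i in auto)
      moreover have "w i = 2 * p \<Longrightarrow> grid_point p w i = 1" using p by (simp add: grid_point_def)
      ultimately show ?thesis using \<open>down (w, l) i\<close> by (auto simp: down_def)
    qed
    then have up: "Y ?x j i - ?x i \<le> 1 / p + ?K" using w(3,4) by linarith
    obtain k' where k': "k' \<le> m" "L (flag_cell h \<pi> k') v j = m" using lab[of m] by auto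
    obtain w' l' where w': "\<bar>?x i - grid_point p w' i\<bar> \<le> 1 / p"
       "\<bar>Y ?x j i - Y (grid_point p w') l' i\<bar> \<le> ?K" "rep (flag_cell h \<pi> k') (v, j) = (w', l')"
      using *[OF k'(1)] by blast
    have "\<not> down (w', l') i"
      using Least_le_bound(3)[of i m "down (w', l')"] k'(2) i w'(3) unfolding L_def by auto
    then have "Y (grid_point p w') l' i \<ge> grid_point p w' i" by (auto simp: down_def)
    then have "?x i - Y ?x j i \<le> 1 / p + ?K" using w'(1,2) by linarith
    with up show ?thesis by (simp add: abs_le_iff)
  qed
  then show ?thesis using x01 j by (intro exI[of _ ?x]) auto
qed

section \<open>Uniform continuity and metric estimates\<close>

lemma (in Metric_space) uniformly_continuous_from_compact:
  fixes S :: "'b::metric_space set"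
  assumes "compact S" "continuous_map (top_of_set S) mtopology g" "e > 0"
  shows "\<exists>\<delta>>0. \<forall>x\<in>S. \<forall>y\<in>S. dist x y < \<delta> \<longrightarrow> d (g x) (g y) < e"
proof -
  define \<G> where "\<G> = {T. open T \<and> (\<forall>y\<in>S \<inter> T. \<forall>z\<in>S \<inter> T. d (g y) (g z) < e)}"
  have "S \<subseteq> \<Union>\<G>"
  proof
    fix x assume x: "x \<in> S"
    obtain U where U: "openin (top_of_set S) U" "x \<in> U" "\<forall>y\<in>U. g y \<in> mball (g x) (e / 2)"
      using assms(2) x \<open>e > 0\<close> unfolding continuous_map_to_metric by (metis half_gt_zero topspace_euclidean_subtopology)
    obtain T where T: "open T" "U = S \<inter> T" using U(1) by (auto simp: openin_open)
    have "d (g y) (g z) < e" if "y \<in> S \<inter> T" "z \<in> S \<inter> T" for y z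
    proof -
      have "g x \<in> M" "g y \<in> M" "g z \<in> M" "d (g x) (g y) < e / 2" "d (g x) (g z) < e / 2"
        using U(3) T(2) that by (auto simp: in_mball)
      then show ?thesis using triangle[of "g y" "g x" "g z"] commute[of "g y" "g x"] by linarith
    qed
    then have "T \<in> \<G>" using T(1) by (auto simp: \<G>_def)
    then show "x \<in> \<Union>\<G>" using U(2) T(2) by auto
  qed
  then obtain \<delta> where \<delta>: "0 < \<delta>" "\<And>x. x \<in> S \<Longrightarrow> \<exists>G\<in>\<G>. ball x \<delta> \<subseteq> G"
    using Heine_Borel_lemma[OF assms(1)] by (metis (no_types, lifting) \<G>_def mem_Collect_eq)
  have "d (g x) (g y) < e" if "x \<in> S" "y \<in> S" "dist x y < \<delta>" for x y
  proof -
    obtain G where G: "G \<in> \<G>" "ball x \<delta> \<subseteq> G" using \<delta>(2)[OF \<open>x \<in> S\<close>] by blast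
    then have "x \<in> S \<inter> G" "y \<in> S \<inter> G" using that \<delta>(1) by auto
    then show ?thesis using G(1) by (auto simp: \<G>_def)
  qed
  then show ?thesis using \<delta>(1) by blast
qed

lemma compact_unit_cube: "compact {x :: nat \<Rightarrow> real. \<forall>i. x i \<in> {0..1}}"
proof -
  have "compactin (product_topology (\<lambda>i. euclidean) UNIV) (PiE UNIV (\<lambda>i::nat. {0..1::real}))"
    unfolding compactin_PiE by (auto simp: compactin_euclidean_iff)
  moreover have "PiE UNIV (\<lambda>i::nat. {0..1::real}) = {x. \<forall>i. x i \<in> {0..1}}"
    by (auto simp: PiE_iff)
  ultimately show ?thesis by (simp add: euclidean_product_topology compactin_euclidean_iff)
qed

lemma dist_fun_le:
  fixes x y :: "nat \<Rightarrow> real"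
  assumes "\<And>i. \<bar>x i - y i\<bar> \<le> \<eta>"
  shows "dist x y \<le> 2 * \<eta>"
proof -
  have \<eta>: "0 \<le> \<eta>" using assms[of 0] by linarith
  have "dist x y = (\<Sum>n. (1/2)^n * min (dist (x (from_nat n)) (y (from_nat n))) 1)"
    by (rule dist_fun_def)
  also have "\<dots> \<le> (\<Sum>n. (1/2)^n * \<eta>)"
  proof (rule suminf_le)
    show "(1/2)^n * min (dist (x (from_nat n)) (y (from_nat n))) 1 \<le> (1/2)^n * \<eta>" for n
      using assms[of "from_nat n"] by (intro mult_left_mono) (auto simp: dist_real_def)
    show "summable (\<lambda>n. (1/2)^n * \<eta>)" by (intro summable_mult2 summable_geometric) simp
    show "summable (\<lambda>n. (1/2)^n * min (dist (x (from_nat n)) (y (from_nat n))) 1)"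
      by (rule summable_comparison_test'[of "\<lambda>n. (1/2)^n" 0]) auto
  qed
  also have "\<dots> = (\<Sum>n. (1/2)^n) * \<eta>" by (rule suminf_mult2[symmetric]) simp
  also have "(\<Sum>n. (1/2::real)^n) = 2" by (subst suminf_geometric) auto
  finally show ?thesis .
qed

lemma infdist_le_add_hausdist:
  fixes K L :: "'a::heine_borel set"
  assumes "K \<in> compacts UNIV" "L \<in> compacts UNIV"
  shows "infdist x K \<le> infdist x L + hausdist K L"
proof -
  obtain b where b: "b \<in> L" "infdist x L = dist x b"
    using infdist_attains_inf[of L x] assms(2) by (auto simp: compacts_def compact_imp_closed)
  have "infdist b K \<le> hausdist K L" using hausdist_le_iff[OF assms] b(1) by blast
  then show ?thesis using infdist_triangle[of x K b] b(2) by linarith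
qed

lemma config_representative:
  assumes "P \<in> config_space M X"
  obtains x where "x \<in> tuples M X" "P = perm_rel M X `` {x}"
  using assms that unfolding config_space_def by (metis quotientE)

lemma bij_betw_PiE_permutes:
  assumes "\<And>i. i \<in> I \<Longrightarrow> \<sigma> i permutes B i"
  shows "bij_betw (\<lambda>j. \<lambda>i\<in>I. \<sigma> i (j i)) (PiE I B) (PiE I B)"
proof (rule bij_betw_byWitness[of _ "\<lambda>j. \<lambda>i\<in>I. inv_into UNIV (\<sigma> i) (j i)"])
  have in_B: "\<sigma> i b \<in> B i" "inv_into UNIV (\<sigma> i) b \<in> B i" if "i \<in> I" "b \<in> B i" for i b
    using that permutes_in_image[OF assms] permutes_in_image[OF permutes_inv[OF assms]] by auto
  show "(\<lambda>j. \<lambda>i\<in>I. \<sigma> i (j i)) ` PiE I B \<subseteq> PiE I B" "(\<lambda>j. \<lambda>i\<in>I. inv_into UNIV (\<sigma> i) (j i)) ` PiE I B \<subseteq> PiE I B"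
    using in_B by (auto simp: PiE_iff)
  show "\<forall>j\<in>PiE I B. (\<lambda>i\<in>I. inv_into UNIV (\<sigma> i) ((\<lambda>i\<in>I. \<sigma> i (j i)) i)) = j"
    using permutes_inverses[OF assms] by (auto simp: PiE_iff extensional_def fun_eq_iff)
  show "\<forall>j\<in>PiE I B. (\<lambda>i\<in>I. \<sigma> i ((\<lambda>i\<in>I. inv_into UNIV (\<sigma> i) (j i)) i)) = j"
    using permutes_inverses[OF assms] by (auto simp: PiE_iff extensional_def fun_eq_iff)
qed

lemma mixed_strategies_simps:
  assumes "S \<noteq> {}"
  shows "mixed_strategies S \<noteq> {}" "compact (mixed_strategies S)" "convex (mixed_strategies S)"
    "x \<in> mixed_strategies S \<Longrightarrow> x $ s \<in> {0..1}"
proof -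
  show range: "x $ s \<in> {0..1}" if "x \<in> mixed_strategies S" for x s
  proof (cases "s \<in> S")
    case True
    have "x $ s \<le> (\<Sum>s\<in>S. x $ s)" using that True
      by (intro member_le_sum) (auto simp: mixed_strategies_def)
    then show ?thesis using that by (auto simp: mixed_strategies_def)
  qed (use that in \<open>auto simp: mixed_strategies_def\<close>)
  obtain s where "s \<in> S" using assms by auto
  then have "axis s 1 \<in> mixed_strategies S"
    by (auto simp: mixed_strategies_def axis_def if_distrib cong: if_cong)
  then show "mixed_strategies S \<noteq> {}" by auto
  have "mixed_strategies S = (\<Inter>s. {x. 0 \<le> x $ s}) \<inter> (\<Inter>s\<in>-S. {x. x $ s = 0}) \<inter> {x. (\<Sum>s\<in>S. x $ s) = 1}"
    by (auto simp: mixed_strategies_def)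
  moreover have "closed \<dots>"
    by (intro closed_Int closed_INT ballI closed_Collect_le closed_Collect_eq continuous_intros)
  ultimately have "closed (mixed_strategies S)" by simp
  moreover have "bounded (mixed_strategies S)"
  proof (rule boundedI)
    fix x assume x: "x \<in> mixed_strategies S"
    have "norm x \<le> (\<Sum>s\<in>UNIV. \<bar>x $ s\<bar>)" by (rule norm_le_l1_cart)
    also have "\<dots> \<le> (\<Sum>s\<in>(UNIV :: 'a set). 1)" using range[OF x] by (intro sum_mono) (auto simp: abs_le_iff intro: order_trans)
    finally show "norm x \<le> real CARD('a)" by simp
  qed
  ultimately show "compact (mixed_strategies S)" by (simp add: compact_eq_bounded_closed)
  show "convex (mixed_strategies S)"
    by (rule convexI) (auto simp: mixed_strategies_def sum.distrib simp flip: sum_distrib_left)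
qed

section \<open>Equilibria\<close>

lemma approximate_equilibrium:
  fixes A :: "nat \<Rightarrow> (real ^ 's::finite) set"
  assumes A: "\<And>i. i \<in> {1..N} \<Longrightarrow> A i \<noteq> {} \<and> compact (A i) \<and> convex (A i) \<and> (\<forall>x\<in>A i. \<forall>s. x $ s \<in> {0..1})"
    and M: "\<And>i. i \<in> {1..N} \<Longrightarrow> M i > 0"
    and g: "\<And>i. i \<in> {1..N} \<Longrightarrow> continuous_map (others_topology N A i)
           (Metric_space.mtopology (config_space (M i) (A i)) (config_dist (M i) (A i))) (g i)"
    and "\<epsilon> > 0"
  shows "\<exists>a\<in>profiles N A. \<forall>i\<in>{1..N}. \<exists>y\<in>config_set (M i) (g i (restrict a ({1..N} - {i}))). dist (a i) y < \<epsilon>"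
proof -
  let ?I = "{1..N}"
  define P where "P = ?I \<times> (UNIV :: 's set)"
  define m where "m = card P"
  obtain e where e: "bij_betw e {0..<m} P"
    using ex_bij_betw_nat_finite[of P] by (auto simp: P_def m_def)
  define idx where "idx i s = inv_into {0..<m} e (i, s)" for i s
  have idx: "e (idx i s) = (i, s)" "idx i s < m" if "i \<in> ?I" for i s
    using bij_betw_inv_into_right[OF e, of "(i, s)"] bij_betwE[OF bij_betw_inv_into[OF e]] that
    by (auto simp: idx_def P_def)
  have e_in: "fst (e k) \<in> ?I" if "k < m" for k
  proof -
    have "e k \<in> P" using bij_betwE[OF e] that by simp
    then show ?thesis by (metis P_def SigmaD1 prod.collapse)
  qed
  define Q where "Q = {x :: nat \<Rightarrow> real. \<forall>i. x i \<in> {0..1}}"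
  define block where "block x i = (\<chi> s. x (idx i s))" for x :: "nat \<Rightarrow> real" and i
  define prof where "prof x i = closest_point (A i) (block x i)" for x i
  define oth where "oth x i = restrict (prof x) (?I - {i})" for x i
  have prof_in: "prof x i \<in> A i" if "i \<in> ?I" for x i
    using A[OF that] by (auto simp: prof_def compact_imp_closed intro: closest_point_in_set)
  have oth_in: "oth x i \<in> others N A i" for x i
    using prof_in by (auto simp: oth_def others_def)
  have oth_cont: "continuous_map (top_of_set Q) (others_topology N A i) (\<lambda>x. oth x i)" for i
    unfolding others_topology_def continuous_map_componentwise
  proof (intro conjI ballI)
    show "(\<lambda>x. oth x i) ` topspace (top_of_set Q) \<subseteq> extensional (?I - {i})" by (auto simp: oth_def)
    fix k assume k: "k \<in> ?I - {i}"
    have "continuous_on Q (\<lambda>x. block x k)"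
      unfolding block_def
      by (intro continuous_on_vec_lambda continuous_on_subset[OF continuous_on_product_coordinates]) auto
    then have "continuous_on Q (\<lambda>x. prof x k)"
      unfolding prof_def using A[of k] k
      by (intro continuous_on_compose2[OF continuous_on_closest_point[of "A k" UNIV]]) (auto simp: compact_imp_closed)
    then have "continuous_map (top_of_set Q) (top_of_set (A k)) (\<lambda>x. prof x k)"
      using prof_in[of k] k by (auto simp: continuous_map_in_subtopology)
    then show "continuous_map (top_of_set Q) (top_of_set (A k)) (\<lambda>x. oth x i k)"
      using k by (simp add: oth_def)
  qed
  have "\<exists>t. t \<in> tuples (M i) (A i) \<and> g i (oth x i) = perm_rel (M i) (A i) `` {t}" if i: "i \<in> ?I" for x i
  proof -
    interpret Metric_space "config_space (M i) (A i)" "config_dist (M i) (A i)"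
      by (rule Metric_space_config_dist[OF M[OF i]])
    have "g i (oth x i) \<in> config_space (M i) (A i)"
      using continuous_map_image_subset_topspace[OF g[OF i]] oth_in[of x i]
      by (auto simp: topspace_others_topology)
    then show ?thesis by (metis config_representative)
  qed
  then obtain t where t: "t i x \<in> tuples (M i) (A i)" "g i (oth x i) = perm_rel (M i) (A i) `` {t i x}"
    if "i \<in> ?I" for i x by metis
  have t_in: "t i x l \<in> A i" if "i \<in> ?I" "l < M i" for i x l
    using t(1)[OF that(1), of x] that(2) by (auto simp: tuples_def)
  define J where "J = PiE ?I (\<lambda>i. {..<M i})"
  have J: "finite J" "J \<noteq> {}"
  proof -
    show "finite J" unfolding J_def by (intro finite_PiE) auto
    have "(\<lambda>i\<in>?I. 0) \<in> J" using M by (auto simp: J_def)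
    then show "J \<noteq> {}" by blast
  qed
  define Y where "Y x j k = t (fst (e k)) x (j (fst (e k))) $ snd (e k)" for x j k
  define \<epsilon>' where "\<epsilon>' = \<epsilon> / (2 * CARD('s))"
  have \<epsilon>': "\<epsilon>' > 0" "CARD('s) * \<epsilon>' < \<epsilon>" using \<open>\<epsilon> > 0\<close> by (auto simp: \<epsilon>'_def field_simps)
  define K where "K = real ((2 ^ m * card J)\<^sup>2)"
  have K: "K \<ge> 0" by (simp add: K_def)
  define \<delta> where "\<delta> = \<epsilon>' / (2 * (K + 1))"
  have \<delta>: "\<delta> > 0" "K * \<delta> \<le> \<epsilon>' / 2"
    using \<epsilon>'(1) K by (auto simp: \<delta>_def field_simps)
  have "\<exists>d>0. \<forall>x\<in>Q. \<forall>y\<in>Q. dist x y < d \<longrightarrow>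
      config_dist (M i) (A i) (g i (oth x i)) (g i (oth y i)) < \<delta>" if i: "i \<in> ?I" for i
  proof -
    interpret Metric_space "config_space (M i) (A i)" "config_dist (M i) (A i)"
      by (rule Metric_space_config_dist[OF M[OF i]])
    show ?thesis
      using uniformly_continuous_from_compact[of Q "\<lambda>x. g i (oth x i)" \<delta>] compact_unit_cube \<delta>(1)
        continuous_map_compose[OF oth_cont g[OF i]]
      by (auto simp: Q_def o_def)
  qed
  then have "\<exists>d. \<forall>i\<in>?I. d i > 0 \<and> (\<forall>x\<in>Q. \<forall>y\<in>Q. dist x y < d i \<longrightarrow>
      config_dist (M i) (A i) (g i (oth x i)) (g i (oth y i)) < \<delta>)"
    by (intro bchoice ballI)
  then obtain d where d: "\<And>i. i \<in> ?I \<Longrightarrow> d i > 0"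
    "\<And>i x y. \<lbrakk>i \<in> ?I; x \<in> Q; y \<in> Q; dist x y < d i\<rbrakk> \<Longrightarrow>
      config_dist (M i) (A i) (g i (oth x i)) (g i (oth y i)) < \<delta>" by blast
  define D where "D = Min (insert 1 (d ` ?I))"
  have D: "D > 0" "\<And>i. i \<in> ?I \<Longrightarrow> D \<le> d i"
  proof -
    show "D > 0" unfolding D_def using d(1) by (subst Min_gr_iff) auto
    show "D \<le> d i" if "i \<in> ?I" for i unfolding D_def using that by (intro Min_le) auto
  qed
  obtain p :: nat where p: "real p > max (2 / D) (2 / \<epsilon>')" using reals_Archimedean2 by blast
  moreover have "2 / D > 0" using D(1) by simp
  ultimately have p0: "p > 0" by (metis max_less_iff_conj less_trans of_nat_0_less_iff)
  have p1: "2 * (1 / p) < D" "1 / p \<le> \<epsilon>' / 2"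
    using p p0 D(1) \<epsilon>'(1) by (auto simp: field_simps)
  have "\<exists>x. (\<forall>i. x i \<in> {0..1}) \<and> (\<exists>j\<in>J. \<forall>i<m. \<bar>Y x j i - x i\<bar> \<le> 1 / p + real ((2 ^ m * card J)\<^sup>2) * \<delta>)"
  proof (rule approx_fixed_point_grid[OF J p0])
    fix x :: "nat \<Rightarrow> real" and j k assume "j \<in> J" "k < m"
    then have i: "fst (e k) \<in> ?I" and "j (fst (e k)) < M (fst (e k))"
      using e_in[of k] by (auto simp: J_def PiE_iff)
    then show "Y x j k \<in> {0..1}"
      unfolding Y_def using A[OF i] t_in[OF i] by blast
  next
    fix x x' :: "nat \<Rightarrow> real"
    assume x: "\<And>i. x i \<in> {0..1}" "\<And>i. x' i \<in> {0..1}" "\<And>i. \<bar>x i - x' i\<bar> \<le> 1 / p"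
    have "dist x' x \<le> 2 * (1 / p)" using dist_fun_le[of x x' "1 / p"] x(3) by (simp add: dist_commute)
    then have dist: "dist x' x < d i" if "i \<in> ?I" for i using p1(1) D(2)[OF that] by linarith
    have "\<exists>\<sigma>. \<sigma> permutes {..<M i} \<and> (\<forall>l<M i. dist (t i x' (\<sigma> l)) (t i x l) \<le> \<delta>)" if i: "i \<in> ?I" for i
    proof -
      have "config_dist (M i) (A i) (g i (oth x' i)) (g i (oth x i)) < \<delta>"
        using d(2)[OF i _ _ dist[OF i]] x by (auto simp: Q_def)
      then have "perm_dist (M i) (t i x') (t i x) \<le> \<delta>"
        using config_dist_class[OF M[OF i] t(1)[OF i] t(1)[OF i], of x' x] t(2)[OF i] by simp
      then show ?thesis by (simp add: perm_dist_le_iff[OF M[OF i]])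
    qed
    then obtain \<sigma> where \<sigma>: "\<sigma> i permutes {..<M i}" "\<forall>l<M i. dist (t i x' (\<sigma> i l)) (t i x l) \<le> \<delta>"
      if "i \<in> ?I" for i by metis
    define \<beta> where "\<beta> j = (\<lambda>i\<in>?I. \<sigma> i (j i))" for j
    have "bij_betw \<beta> J J"
      unfolding \<beta>_def J_def using \<sigma>(1) by (rule bij_betw_PiE_permutes)
    moreover have "\<bar>Y x j k - Y x' (\<beta> j) k\<bar> \<le> \<delta>" if "j \<in> J" "k < m" for j k
    proof -
      let ?i = "fst (e k)"
      have i: "?i \<in> ?I" using e_in[OF that(2)] .
      have l: "j ?i < M ?i" using that(1) i by (auto simp: J_def PiE_iff)
      have "\<bar>Y x j k - Y x' (\<beta> j) k\<bar> = \<bar>(t ?i x (j ?i) - t ?i x' (\<sigma> ?i (j ?i))) $ snd (e k)\<bar>"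
        using i by (simp add: Y_def \<beta>_def)
      also have "\<dots> \<le> dist (t ?i x' (\<sigma> ?i (j ?i))) (t ?i x (j ?i))"
        by (metis component_le_norm_cart dist_commute dist_norm)
      also have "\<dots> \<le> \<delta>" using \<sigma>(2)[OF i] l by blast
      finally show ?thesis .
    qed
    ultimately show "\<exists>\<beta>. bij_betw \<beta> J J \<and> (\<forall>j\<in>J. \<forall>k<m. \<bar>Y x j k - Y x' (\<beta> j) k\<bar> \<le> \<delta>)" by blast
  qed
  then obtain x j where j: "j \<in> J" and xj: "\<And>k. k < m \<Longrightarrow> \<bar>Y x j k - x k\<bar> \<le> 1 / p + K * \<delta>"
    unfolding K_def by blast
  define a where "a = restrict (prof x) ?I"
  have "a \<in> profiles N A" using prof_in by (auto simp: a_def profiles_def)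
  moreover have "\<exists>y\<in>config_set (M i) (g i (restrict a (?I - {i}))). dist (a i) y < \<epsilon>" if i: "i \<in> ?I" for i
  proof
    let ?y = "t i x (j i)"
    have l: "j i < M i" using j i by (auto simp: J_def PiE_iff)
    have "restrict a (?I - {i}) = oth x i" by (auto simp: a_def oth_def)
    then show "?y \<in> config_set (M i) (g i (restrict a (?I - {i})))"
      using t(2)[OF i] config_set_class[OF t(1)[OF i]] l by simp
    have "dist (a i) ?y = dist (closest_point (A i) (block x i)) (closest_point (A i) ?y)"
      using i closest_point_self[OF t_in[OF i l]] by (simp add: a_def prof_def)
    also have "\<dots> \<le> dist (block x i) ?y"
      using A[OF i] by (intro closest_point_lipschitz) (auto simp: compact_imp_closed)
    also have "\<dots> \<le> (\<Sum>s\<in>UNIV. \<bar>(block x i - ?y) $ s\<bar>)"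
      unfolding dist_norm by (rule norm_le_l1_cart)
    also have "\<dots> \<le> (\<Sum>s\<in>(UNIV :: 's set). \<epsilon>')"
    proof (rule sum_mono)
      fix s
      show "\<bar>(block x i - ?y) $ s\<bar> \<le> \<epsilon>'"
        using xj[OF idx(2)[OF i], of s] idx(1)[OF i, of s] p1(2) \<delta>(2) by (simp add: Y_def block_def abs_minus_commute)
    qed
    also have "\<dots> < \<epsilon>" using \<epsilon>'(2) by simp
    finally show "dist (a i) ?y < \<epsilon>" .
  qed
  ultimately show ?thesis by blast
qed

lemma continuous_map_infdist:
  fixes a :: "'b \<Rightarrow> 'a::heine_borel"
  assumes a: "continuous_map X euclidean a"
    and R: "continuous_map X (Metric_space.mtopology (compacts B) hausdist) R"
  shows "continuous_map X euclideanreal (\<lambda>x. infdist (a x) (R x))"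
proof -
  interpret H: Metric_space "compacts B" hausdist by (rule Metric_space_hausdist)
  have R_in: "R x \<in> compacts UNIV" if "x \<in> topspace X" for x
  proof -
    have "R x \<in> compacts B"
      using continuous_map_image_subset_topspace[OF R] that by auto
    then show ?thesis by (auto simp: compacts_def)
  qed
  have "continuous_map X Met_TC.mtopology (\<lambda>x. infdist (a x) (R x))"
    unfolding Met_TC.continuous_map_to_metric
  proof (intro ballI allI impI)
    fix x and \<epsilon> :: real assume x: "x \<in> topspace X" and "\<epsilon> > 0"
    then have "\<epsilon> / 2 > 0" by simp
    obtain U where U: "openin X U" "x \<in> U" "\<forall>y\<in>U. dist (a x) (a y) < \<epsilon> / 2"
      using a x \<open>\<epsilon> / 2 > 0\<close> unfolding mtopology_is_euclidean[symmetric] Met_TC.continuous_map_to_metric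
      by (metis Met_TC.in_mball)
    obtain V where V: "openin X V" "x \<in> V" "\<forall>y\<in>V. hausdist (R x) (R y) < \<epsilon> / 2"
      using R x \<open>\<epsilon> / 2 > 0\<close> unfolding H.continuous_map_to_metric by (metis H.in_mball)
    have "dist (infdist (a x) (R x)) (infdist (a y) (R y)) < \<epsilon>" if y: "y \<in> U \<inter> V" for y
    proof -
      have top: "y \<in> topspace X" using y openin_subset[OF U(1)] by auto
      have "infdist (a x) (R x) \<le> infdist (a y) (R x) + dist (a x) (a y)"
        "infdist (a y) (R x) \<le> infdist (a x) (R x) + dist (a y) (a x)"
        "infdist (a y) (R x) \<le> infdist (a y) (R y) + hausdist (R x) (R y)"
        "infdist (a y) (R y) \<le> infdist (a y) (R x) + hausdist (R y) (R x)"
        by (intro infdist_triangle infdist_le_add_hausdist R_in x top)+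
      moreover have "hausdist (R y) (R x) = hausdist (R x) (R y)" by (rule H.commute)
      moreover have "dist (a x) (a y) < \<epsilon> / 2" "hausdist (R x) (R y) < \<epsilon> / 2" using U V y by auto
      ultimately show ?thesis by (simp add: dist_real_def abs_less_iff dist_commute)
    qed
    then show "\<exists>U. openin X U \<and> x \<in> U \<and> (\<forall>y\<in>U. infdist (a y) (R y) \<in> Met_TC.mball (infdist (a x) (R x)) \<epsilon>)"
      using U V by (intro exI[of _ "U \<inter> V"]) auto
  qed
  then show ?thesis by simp
qed

theorem theorem3p2:
  fixes N :: nat and n :: "nat \<Rightarrow> nat" and S :: "nat \<Rightarrow> 's::finite set"
    and A :: "nat \<Rightarrow> (real ^ 's) set"
    and r :: "nat \<Rightarrow> real ^ 's \<Rightarrow> (nat \<Rightarrow> real ^ 's) \<Rightarrow> real"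
  assumes "N \<ge> 1"
    and "\<And>i. i \<in> {1..N} \<Longrightarrow> card (S i) = n i + 1"
    and "\<And>i. i \<in> {1..N} \<Longrightarrow> A i = mixed_strategies (S i)"
    and "\<And>i b. i \<in> {1..N} \<Longrightarrow> b \<in> others N A i \<Longrightarrow> best_response A r i b \<in> compacts (A i)"
    and "\<And>i. i \<in> {1..N} \<Longrightarrow>
           continuous_map (others_topology N A i) (Metric_space.mtopology (compacts (A i)) hausdist)
             (best_response A r i)"
    and "\<And>i. i \<in> {1..N} \<Longrightarrow> weakly_configurable N A r i"
  shows "(\<Inter>i\<in>{1..N}. graph_in_profiles N A i (best_response A r i)) \<noteq> {} \<and>
         (\<exists>a. nash_equilibrium N A r a)"
proof -
  let ?I = "{1..N}"
  let ?R = "\<lambda>i. best_response A r i"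
  have A: "A i \<noteq> {} \<and> compact (A i) \<and> convex (A i) \<and> (\<forall>x\<in>A i. \<forall>s. x $ s \<in> {0..1})" if i: "i \<in> ?I" for i
  proof -
    have "S i \<noteq> {}" using assms(2)[OF i] by auto
    then show ?thesis unfolding assms(3)[OF i]
      by (intro conjI ballI allI) (rule mixed_strategies_simps, assumption+)+
  qed
  define X where "X = product_topology (\<lambda>j. top_of_set (A j)) ?I"
  have topX: "topspace X = profiles N A" by (simp add: X_def profiles_def)
  have oth: "restrict a (?I - {i}) \<in> others N A i" if "a \<in> profiles N A" for a i
    using that by (auto simp: profiles_def others_def)
  define D where "D i a = infdist (a i) (?R i (restrict a (?I - {i})))" for i and a :: "nat \<Rightarrow> real ^ 's"
  have cont_D: "continuous_map X euclideanreal (D i)" if i: "i \<in> ?I" for i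
    unfolding D_def
  proof (rule continuous_map_infdist)
    have proj: "continuous_map X (top_of_set (A k)) (\<lambda>a. a k)" if "k \<in> ?I" for k
      unfolding X_def using that by (rule continuous_map_product_projection)
    show "continuous_map X euclidean (\<lambda>a. a i)"
      using proj[OF i] by (rule continuous_map_into_fulltopology)
    have "continuous_map X (others_topology N A i) (\<lambda>a. restrict a (?I - {i}))"
      unfolding others_topology_def continuous_map_componentwise using proj by auto
    then show "continuous_map X (Metric_space.mtopology (compacts (A i)) hausdist)
        (\<lambda>a. ?R i (restrict a (?I - {i})))"
      using continuous_map_compose[OF _ assms(5)[OF i]] by (simp add: o_def)
  qed
  define E where "E a = (\<Sum>i\<in>?I. D i a)" for a
  have "continuous_map X euclideanreal E"
    unfolding E_def by (intro continuous_map_sum cont_D) auto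
  moreover have "compact_space X"
    using A by (auto simp: X_def compact_space_product_topology compact_space_subtopology)
  ultimately have "compact (E ` profiles N A)"
    using image_compactin[of X "topspace X" euclideanreal E] by (simp add: compact_space_def topX)
  moreover have "profiles N A \<noteq> {}" using A by (auto simp: profiles_def PiE_eq_empty_iff)
  ultimately obtain a where a: "a \<in> profiles N A" "\<And>b. b \<in> profiles N A \<Longrightarrow> E a \<le> E b"
    using compact_attains_inf[of "E ` profiles N A"] by auto
  have D_nonneg: "0 \<le> D i b" for i b by (simp add: D_def infdist_nonneg)
  have small: "\<exists>b\<in>profiles N A. E b < \<eta>" if "\<eta> > 0" for \<eta>
  proof -
    define \<epsilon> where "\<epsilon> = \<eta> / (2 * N)"
    have \<epsilon>: "\<epsilon> > 0" using that assms(1) by (simp add: \<epsilon>_def)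
    have "\<forall>i\<in>?I. \<exists>F M g. M > 0 \<and> F \<in> others N A i \<rightarrow> compacts (A i) \<and> continuous_map (others_topology N A i)
           (Metric_space.mtopology (config_space M (A i)) (config_dist M (A i))) g \<and>
         (\<forall>b\<in>others N A i. config_set M (g b) \<subseteq> F b) \<and> (\<forall>b\<in>others N A i. hausdist (?R i b) (F b) < \<epsilon>)"
      using assms(6) \<epsilon> unfolding weakly_configurable_def subset_liftable_def by meson
    then obtain F M g where F: "\<And>i. i \<in> ?I \<Longrightarrow> M i > (0::nat)"
      "\<And>i. i \<in> ?I \<Longrightarrow> F i \<in> others N A i \<rightarrow> compacts (A i)"
      "\<And>i. i \<in> ?I \<Longrightarrow> continuous_map (others_topology N A i)
           (Metric_space.mtopology (config_space (M i) (A i)) (config_dist (M i) (A i))) (g i)"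
      "\<And>i b. i \<in> ?I \<Longrightarrow> b \<in> others N A i \<Longrightarrow> config_set (M i) (g i b) \<subseteq> F i b"
      "\<And>i b. i \<in> ?I \<Longrightarrow> b \<in> others N A i \<Longrightarrow> hausdist (?R i b) (F i b) < \<epsilon>"
      unfolding bchoice_iff by (elim exE) blast
    obtain b where b: "b \<in> profiles N A"
      "\<And>i. i \<in> ?I \<Longrightarrow> \<exists>y\<in>config_set (M i) (g i (restrict b (?I - {i}))). dist (b i) y < \<epsilon>"
      using approximate_equilibrium[OF A F(1) F(3) \<epsilon>] by blast
    have "D i b < 2 * \<epsilon>" if i: "i \<in> ?I" for i
    proof -
      let ?b = "restrict b (?I - {i})"
      obtain y where y: "y \<in> config_set (M i) (g i ?b)" "dist (b i) y < \<epsilon>" using b(2)[OF i] by blast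
      have yF: "y \<in> F i ?b" using F(4)[OF i oth[OF b(1)]] y(1) by blast
      have "?R i ?b \<in> compacts UNIV" "F i ?b \<in> compacts UNIV"
        using assms(4)[OF i oth[OF b(1)]] F(2)[OF i] oth[OF b(1)] by (auto simp: compacts_def Pi_iff)
      then have "infdist y (?R i ?b) \<le> hausdist (?R i ?b) (F i ?b)" using hausdist_le_iff yF by blast
      then show ?thesis
        using F(5)[OF i oth[OF b(1)]] y(2) infdist_triangle[of "b i" "?R i ?b" y] by (simp add: D_def)
    qed
    then have "E b < (\<Sum>i\<in>?I. 2 * \<epsilon>)"
      unfolding E_def using assms(1) by (intro sum_strict_mono) auto
    also have "\<dots> = \<eta>" using assms(1) by (simp add: \<epsilon>_def)
    finally show ?thesis using b(1) by blast
  qed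
  have "E a \<le> 0" using small[of "E a"] a(2) by force
  then have "E a = 0" unfolding E_def by (simp add: D_nonneg sum_nonneg antisym)
  then have D0: "D i a = 0" if "i \<in> ?I" for i
    using that D_nonneg by (simp add: E_def sum_nonneg_eq_0_iff)
  have best: "a i \<in> ?R i (restrict a (?I - {i}))" if i: "i \<in> ?I" for i
  proof -
    have "closed (?R i (restrict a (?I - {i})))" "?R i (restrict a (?I - {i})) \<noteq> {}"
      using assms(4)[OF i oth[OF a(1)]] by (auto simp: compacts_def compact_imp_closed)
    from in_closed_iff_infdist_zero[OF this] show ?thesis using D0[OF i] by (simp add: D_def)
  qed
  have "a \<in> graph_in_profiles N A i (?R i)" if i: "i \<in> ?I" for i
  proof -
    have "a = (restrict a (?I - {i}))(i := a i)"
      using a(1) i by (auto simp: profiles_def PiE_iff extensional_def fun_eq_iff)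
    then show ?thesis using best[OF i] oth[OF a(1)] unfolding graph_in_profiles_def by blast
  qed
  moreover have "nash_equilibrium N A r a"
    unfolding nash_equilibrium_def
  proof (intro conjI ballI a(1))
    fix i x assume "i \<in> ?I" "x \<in> A i"
    then show "r i (a i) (restrict a (?I - {i})) \<le> r i x (restrict a (?I - {i}))"
      using best[of i] by (auto simp: best_response_def is_arg_min_def not_less)
  qed
  ultimately show ?thesis by blast
qed

end
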